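(* Let $E$ and $F$ be two Banach lattices such that $F$ has property (d). Then the following statements are equivalent: (1) Every order bounded weak almost limited operator $T:E\to F$ is almost limited. (2) Every positive weak almost limited operator $T:E\to F$ is almost limited. (3) One of the following assertions is valid: (i) $F$ has the positive dual Schur property. (ii) The norm of $E^*$ is order continuous.
   Context: All Banach lattices are real; "operator" means bounded linear mapping. A sequence $(f_n)$ in a Banach lattice is disjoint if $|f_n|\wedge|f_m|=0$ for $n\neq m$. A Banach lattice $F$ has property (d) if $|f_n|\xrightarrow{w^*}0$ in $F^*$ for every disjoint sequence $(f_n)$ in $F^*$ with $f_n\xrightarrow{w^*}0$. $F$ has the positive dual Schur property if $\|f_n\|\to 0$ for every weak* null sequence $(f_n)\subset (F^* )^+$. A norm bounded subset $A$ of a Banach lattice $F$ is an almost limited set if every disjoint weak* null sequence $(f_n)$ in $F^*$ satisfies $\sup_{y\in A}|f_n(y)|\to 0$. An operator $T:X\to F$ from a Banach space into a Banach lattice is almost limited if $T(B_X)$ is an almost limited set in $F$, where $B_X$ is the closed unit ball of $X$ (equivalently, $\|T^*f_n\|\to 0$ for every disjoint weak* null sequence $(f_n)\subset F^*$); it is weak almost limited if $T$ carries each relatively weakly compact set in $X$ to an almost limited set in $F$. *)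

theory Defs
  imports "HOL-Analysis.Analysis" "HOL-Library.Lattice_Algebras"
begin

section \<open>Banach lattices\<close>

class banach_lattice = banach + ordered_real_vector + lattice_ab_group_add_abs +
  assumes norm_mono_abs: "\<bar>x\<bar> \<le> \<bar>y\<bar> \<Longrightarrow> norm x \<le> norm y"

text \<open>
  Order continuity of the norm: every decreasing net with infimum \<open>0\<close> tends to \<open>0\<close> in norm.
  A decreasing net is represented by its range, a nonempty downward directed set; by
  monotonicity of the norm, norm convergence to \<open>0\<close> says that the infimum of the norms is \<open>0\<close>.
\<close>

definition order_continuous_norm :: "'a::banach_lattice itself \<Rightarrow> bool" where
  "order_continuous_norm (_ :: 'a itself) \<longleftrightarrow>
     (\<forall>D :: 'a set.
        D \<noteq> {} \<and>
        (\<forall>x\<in>D. \<forall>y\<in>D. \<exists>z\<in>D. z \<le> x \<and> z \<le> y) \<and>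
        (\<forall>x\<in>D. 0 \<le> x) \<and> (\<forall>z. (\<forall>x\<in>D. z \<le> x) \<longrightarrow> z \<le> 0)
        \<longrightarrow> (INF x\<in>D. norm x) = 0)"

definition disjoint_seq :: "(nat \<Rightarrow> 'a::banach_lattice) \<Rightarrow> bool" where
  "disjoint_seq f \<longleftrightarrow> (\<forall>n m. n \<noteq> m \<longrightarrow> inf \<bar>f n\<bar> \<bar>f m\<bar> = 0)"


section \<open>The dual space\<close>

text \<open>
  The topological dual is a copy of \<^typ>\<open>'a \<Rightarrow>\<^sub>L real\<close>, introduced as a type of its own so that it
  can carry the lattice structure of the dual of a Banach lattice.
\<close>

typedef (overloaded) 'a dual = "UNIV :: ('a::real_normed_vector \<Rightarrow>\<^sub>L real) set"
  morphisms dual_blinfun Dual ..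

setup_lifting type_definition_dual

lift_definition dual_apply :: "'a::real_normed_vector dual \<Rightarrow> 'a \<Rightarrow> real" is blinfun_apply .

declare [[coercion dual_apply]]

lemma dual_eqI: "(\<And>x. dual_apply f x = dual_apply g x) \<Longrightarrow> f = g"
  by transfer (rule blinfun_eqI)

instantiation dual :: (real_normed_vector) real_normed_vector
begin

lift_definition zero_dual :: "'a dual" is 0 .
lift_definition plus_dual :: "'a dual \<Rightarrow> 'a dual \<Rightarrow> 'a dual" is "(+)" .
lift_definition minus_dual :: "'a dual \<Rightarrow> 'a dual \<Rightarrow> 'a dual" is "(-)" .
lift_definition uminus_dual :: "'a dual \<Rightarrow> 'a dual" is uminus .
lift_definition scaleR_dual :: "real \<Rightarrow> 'a dual \<Rightarrow> 'a dual" is scaleR .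
lift_definition norm_dual :: "'a dual \<Rightarrow> real" is norm .
definition dist_dual :: "'a dual \<Rightarrow> 'a dual \<Rightarrow> real" where
  "dist_dual f g = norm (f - g)"
definition sgn_dual :: "'a dual \<Rightarrow> 'a dual" where
  "sgn_dual f = inverse (norm f) *\<^sub>R f"
definition uniformity_dual :: "('a dual \<times> 'a dual) filter" where
  "uniformity_dual = (INF e\<in>{0 <..}. principal {(f, g). dist f g < e})"
definition open_dual :: "'a dual set \<Rightarrow> bool" where
  "open_dual U \<longleftrightarrow> (\<forall>f\<in>U. \<forall>\<^sub>F (f', g) in uniformity. f' = f \<longrightarrow> g \<in> U)"

instance
proof
  fix a b :: real and f g h :: "'a dual" and U :: "'a dual set"
  show "dist f g = norm (f - g)" by (rule dist_dual_def)
  show "sgn f = inverse (norm f) *\<^sub>R f" by (rule sgn_dual_def)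
  show "(uniformity :: ('a dual \<times> 'a dual) filter) = (INF e\<in>{0 <..}. principal {(f, g). dist f g < e})"
    by (rule uniformity_dual_def)
  show "open U \<longleftrightarrow> (\<forall>f\<in>U. \<forall>\<^sub>F (f', g) in uniformity. f' = f \<longrightarrow> g \<in> U)" by (rule open_dual_def)
  show "norm (f + g) \<le> norm f + norm g" by transfer (rule norm_triangle_ineq)
qed (transfer; simp add: algebra_simps; fail)+

end

lemma dual_apply_simps [simp]:
  "dual_apply 0 x = 0"
  "dual_apply (f + g) x = dual_apply f x + dual_apply g x"
  "dual_apply (f - g) x = dual_apply f x - dual_apply g x"
  "dual_apply (- f) x = - dual_apply f x"
  "dual_apply (r *\<^sub>R f) x = r * dual_apply f x"
  by (transfer; simp add: blinfun.bilinear_simps)+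

lemma bounded_linear_dual_apply: "bounded_linear (dual_apply f)"
  by transfer (rule blinfun.bounded_linear_right)

lemmas dual_apply_linear =
  bounded_linear.linear [OF bounded_linear_dual_apply, THEN linear_add]
  bounded_linear.linear [OF bounded_linear_dual_apply, THEN linear_diff]
  bounded_linear.linear [OF bounded_linear_dual_apply, THEN linear_neg]
  bounded_linear.linear [OF bounded_linear_dual_apply, THEN linear_0]
  bounded_linear.linear [OF bounded_linear_dual_apply, THEN linear_cmul]

lemma norm_dual_eq_onorm: "norm f = onorm (dual_apply f)"
  by transfer (rule norm_blinfun.rep_eq)

lemma dual_norm_le: "\<bar>dual_apply f x\<bar> \<le> norm f * norm x"
  by transfer (metis norm_blinfun real_norm_def)

lemma dual_norm_bound: "0 \<le> b \<Longrightarrow> (\<And>x. \<bar>dual_apply f x\<bar> \<le> b * norm x) \<Longrightarrow> norm f \<le> b"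
  by transfer (metis norm_blinfun_bound real_norm_def)

lemma ex_dual_apply:
  assumes "bounded_linear h"
  shows "\<exists>f. \<forall>x. dual_apply f x = h x"
  using assms by transfer (metis bounded_linear_Blinfun_apply)

instance dual :: (real_normed_vector) banach
proof
  fix X :: "nat \<Rightarrow> 'a dual"
  assume C: "Cauchy X"
  have d: "dist f g = dist (dual_blinfun f) (dual_blinfun g)" for f g :: "'a dual"
    by (simp add: dist_norm norm_dual.rep_eq minus_dual.rep_eq)
  from C have "Cauchy (\<lambda>n. dual_blinfun (X n))" by (simp add: Cauchy_def d)
  then obtain L where L: "(\<lambda>n. dual_blinfun (X n)) \<longlonglongrightarrow> L"
    using Cauchy_convergent convergent_def by blast
  have "X \<longlonglongrightarrow> Dual L"
    using L by (simp add: tendsto_iff d Dual_inverse)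
  then show "convergent X" by (auto simp: convergent_def)
qed


subsection \<open>Lattice structure (Riesz--Kantorovich)\<close>

lemma riesz_decomposition:
  fixes y a b :: "'a::lattice_ab_group_add"
  assumes "0 \<le> y" "y \<le> a + b" "0 \<le> a" "0 \<le> b"
  obtains u v where "y = u + v" "0 \<le> u" "u \<le> a" "0 \<le> v" "v \<le> b"
proof
  show "y = inf y a + (y - inf y a)" by (simp del: diff_inf_eq_sup)
  show "0 \<le> inf y a" "inf y a \<le> a" using assms by auto
  show "0 \<le> y - inf y a" by (simp del: diff_inf_eq_sup)
  have "y - b \<le> y" "y - b \<le> a" using assms by (auto simp: algebra_simps)
  then have "y - b \<le> inf y a" by simp
  then show "y - inf y a \<le> b" by (metis diff_le_eq add.commute)
qed

lemma dual_ex_pos_part: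
  fixes f :: "'a::banach_lattice dual"
  shows "\<exists>h :: 'a dual. \<forall>x\<ge>0. dual_apply h x = Sup (dual_apply f ` {0..x})"
proof -
  define p where "p x = Sup (dual_apply f ` {0..x})" for x
  have norm_le: "norm y \<le> norm x" if "0 \<le> y" "y \<le> x" for x y :: 'a
    using that by (intro norm_mono_abs) (auto intro: order_trans)
  have bnd: "\<bar>dual_apply f y\<bar> \<le> norm f * norm x" if "y \<in> {0..x}" for x y
    using dual_norm_le[of f y] mult_left_mono[OF norm_le, of y x "norm f"] that by auto
  have bdd: "bdd_above (dual_apply f ` {0..x})" for x
    using bnd[of _ x] by (intro bdd_aboveI2[where M = "norm f * norm x"]) (simp add: abs_le_iff)
  have upper: "dual_apply f y \<le> p x" if "0 \<le> y" "y \<le> x" for x y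
    unfolding p_def by (rule cSup_upper) (use that bdd in auto)
  have least: "p x \<le> c" if "0 \<le> x" "\<And>y. 0 \<le> y \<Longrightarrow> y \<le> x \<Longrightarrow> dual_apply f y \<le> c" for x c
    unfolding p_def by (rule cSup_least) (use that in auto)
  have p_nonneg: "0 \<le> p x" if "0 \<le> x" for x
    using upper[of 0 x] that by (simp add: dual_apply_linear)
  have p_le: "p x \<le> norm f * norm x" if "0 \<le> x" for x
    by (rule least) (use bnd that in fastforce)+
  have p_add: "p (a + b) = p a + p b" if ab: "0 \<le> a" "0 \<le> b" for a b
  proof (rule antisym)
    show "p (a + b) \<le> p a + p b"
    proof (rule least)
      fix y assume "0 \<le> y" "y \<le> a + b"
      then obtain u v where "y = u + v" "0 \<le> u" "u \<le> a" "0 \<le> v" "v \<le> b"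
        using riesz_decomposition ab by blast
      then show "dual_apply f y \<le> p a + p b"
        using upper[of u a] upper[of v b] by (simp add: dual_apply_linear)
    qed (use ab in simp)
    have "p a \<le> p (a + b) - p b"
    proof (rule least[OF ab(1)])
      fix u assume u: "0 \<le> u" "u \<le> a"
      have "p b \<le> p (a + b) - dual_apply f u"
      proof (rule least[OF ab(2)])
        fix v assume v: "0 \<le> v" "v \<le> b"
        show "dual_apply f v \<le> p (a + b) - dual_apply f u"
          using upper[of "u + v" "a + b"] u v by (simp add: dual_apply_linear add_mono)
      qed
      then show "dual_apply f u \<le> p (a + b) - p b" by simp
    qed
    then show "p a + p b \<le> p (a + b)" by simp
  qed
  have p_scale_ge: "c * p x \<le> p (c *\<^sub>R x)" if "0 < c" "0 \<le> x" for c x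
  proof -
    have "p x \<le> p (c *\<^sub>R x) / c"
    proof (rule least[OF that(2)])
      fix y assume "0 \<le> y" "y \<le> x"
      then have "c * dual_apply f y \<le> p (c *\<^sub>R x)"
        using upper[of "c *\<^sub>R y" "c *\<^sub>R x"] \<open>0 < c\<close>
        by (simp add: dual_apply_linear scaleR_left_mono scaleR_nonneg_nonneg)
      then show "dual_apply f y \<le> p (c *\<^sub>R x) / c"
        using \<open>0 < c\<close> by (simp add: field_simps)
    qed
    then show ?thesis using \<open>0 < c\<close> by (simp add: field_simps)
  qed
  have p_zero: "p 0 = 0" using p_add[of 0 0] by simp
  have p_scale: "p (c *\<^sub>R x) = c * p x" if "0 \<le> c" "0 \<le> x" for c x
  proof (cases "c = 0")
    case False
    then have c: "0 < c" using that by simp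
    have "inverse c * p (c *\<^sub>R x) \<le> p x"
      using p_scale_ge[of "inverse c" "c *\<^sub>R x"] c that by (simp add: scaleR_nonneg_nonneg)
    then have "p (c *\<^sub>R x) \<le> c * p x" using c by (simp add: field_simps)
    then show ?thesis using p_scale_ge[OF c that(2)] by simp
  qed (simp add: p_zero)
  define h where "h x = p (pprt x) - p (pprt (- x))" for x
  have split: "x = pprt x - pprt (- x)" for x :: 'a
    using prts[of x] by (simp add: pprt_neg)
  have h_diff: "h (a - b) = p a - p b" if ab: "0 \<le> a" "0 \<le> b" for a b
  proof -
    have "pprt (a - b) + b = a + pprt (- (a - b))"
      using split[of "a - b"] by (simp add: algebra_simps)
    then have "p (pprt (a - b)) + p b = p a + p (pprt (- (a - b)))"
      using p_add ab by (metis zero_le_pprt)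
    then show ?thesis unfolding h_def by simp
  qed
  have "bounded_linear h"
  proof (rule bounded_linear_intro)
    fix x y :: 'a and r :: real
    have "x + y = (pprt x + pprt y) - (pprt (- x) + pprt (- y))"
      by (metis split add_diff_add)
    then show "h (x + y) = h x + h y"
      by (simp only: h_diff add_nonneg_nonneg zero_le_pprt p_add) (simp add: h_def)
    show "h (r *\<^sub>R x) = r *\<^sub>R h x"
    proof (cases "0 \<le> r")
      case True
      have "r *\<^sub>R x = r *\<^sub>R pprt x - r *\<^sub>R pprt (- x)"
        using split[of x] by (metis scaleR_diff_right)
      then show ?thesis
        using True by (simp only: h_diff scaleR_nonneg_nonneg zero_le_pprt p_scale)
          (simp add: h_def algebra_simps)
    next
      case False
      have "r *\<^sub>R x = (- r) *\<^sub>R pprt (- x) - (- r) *\<^sub>R pprt x"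
        using split[of x] by (metis minus_diff_eq scaleR_diff_right scaleR_minus_left)
      moreover have "0 \<le> - r" using False by simp
      ultimately show ?thesis
        by (simp only: h_diff scaleR_nonneg_nonneg zero_le_pprt p_scale)
          (simp add: h_def algebra_simps)
    qed
    have n: "norm (pprt z) \<le> norm z" for z :: 'a
    proof (rule norm_mono_abs)
      have "pprt z \<le> \<bar>z\<bar>" unfolding pprt_def by (simp add: abs_ge_self)
      then show "\<bar>pprt z\<bar> \<le> \<bar>z\<bar>" by simp
    qed
    have q: "0 \<le> p (pprt z)" "p (pprt z) \<le> norm f * norm z" for z
      using p_nonneg[of "pprt z"] p_le[of "pprt z"] mult_left_mono[OF n[of z], of "norm f"]
      by auto
    show "norm (h x) \<le> norm x * norm f"
      unfolding h_def using q[of x] q[of "- x"] by (simp add: mult.commute abs_le_iff)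
  qed
  moreover have "h x = p x" if "0 \<le> x" for x
    using h_diff[of x 0] that p_zero by simp
  ultimately show ?thesis using ex_dual_apply[of h] unfolding p_def by metis
qed

instantiation dual :: (banach_lattice) ord
begin

definition less_eq_dual :: "'a dual \<Rightarrow> 'a dual \<Rightarrow> bool" where
  "f \<le> g \<longleftrightarrow> (\<forall>x\<ge>0. dual_apply f x \<le> dual_apply g x)"

definition less_dual :: "'a dual \<Rightarrow> 'a dual \<Rightarrow> bool" where
  "f < (g :: 'a dual) \<longleftrightarrow> f \<le> g \<and> \<not> g \<le> f"

instance ..

end

instantiation dual :: (banach_lattice) banach_lattice
begin

text \<open>Positive part of a functional, given on positive vectors by the Riesz--Kantorovich formula.\<close>

definition pos_dual :: "'a dual \<Rightarrow> 'a dual" where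
  "pos_dual f = (SOME h. \<forall>x\<ge>0. dual_apply h x = Sup (dual_apply f ` {0..x}))"

definition sup_dual :: "'a dual \<Rightarrow> 'a dual \<Rightarrow> 'a dual" where
  "sup_dual f g = pos_dual (f - g) + g"

definition inf_dual :: "'a dual \<Rightarrow> 'a dual \<Rightarrow> 'a dual" where
  "inf_dual f g = - sup (- f) (- g)"

definition abs_dual :: "'a dual \<Rightarrow> 'a dual" where
  "abs_dual f = sup f (- f)"

lemma pos_dual_apply:
  "0 \<le> x \<Longrightarrow> dual_apply (pos_dual f) x = Sup (dual_apply f ` {0..x})"
  using someI_ex[OF dual_ex_pos_part[of f]] unfolding pos_dual_def by blast

lemma pos_dual_upper:
  assumes "0 \<le> y" "y \<le> x"
  shows "dual_apply f y \<le> dual_apply (pos_dual f) x"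
proof -
  have "dual_apply f z \<le> norm f * norm x" if "z \<in> {0..x}" for z
  proof -
    have "norm z \<le> norm x" using that by (intro norm_mono_abs) (auto intro: order_trans)
    then show ?thesis
      using dual_norm_le[of f z] mult_left_mono[of "norm z" "norm x" "norm f"] by auto
  qed
  then have "bdd_above (dual_apply f ` {0..x})" by (rule bdd_aboveI2)
  then show ?thesis
    using assms by (subst pos_dual_apply) (auto intro!: cSup_upper intro: order_trans)
qed

lemma pos_dual_least:
  assumes "0 \<le> x" "\<And>y. 0 \<le> y \<Longrightarrow> y \<le> x \<Longrightarrow> dual_apply f y \<le> c"
  shows "dual_apply (pos_dual f) x \<le> c"
  using assms by (subst pos_dual_apply) (auto intro!: cSup_least)

instance
proof
  fix f g h :: "'a dual" and a b :: real
  show "f < g \<longleftrightarrow> f \<le> g \<and> \<not> g \<le> f" by (rule less_dual_def)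
  show "f \<le> f" by (simp add: less_eq_dual_def)
  show "f \<le> h" if "f \<le> g" "g \<le> h" using that unfolding less_eq_dual_def by force
  show "f = g" if "f \<le> g" "g \<le> f"
  proof (rule dual_eqI)
    fix x :: 'a
    have "dual_apply f y = dual_apply g y" if "0 \<le> y" for y
      using \<open>f \<le> g\<close> \<open>g \<le> f\<close> that unfolding less_eq_dual_def by (simp add: antisym)
    then have "dual_apply f (pprt x) = dual_apply g (pprt x)"
      "dual_apply f (pprt (- x)) = dual_apply g (pprt (- x))" by simp_all
    moreover have "x = pprt x - pprt (- x)" using prts[of x] by (simp add: pprt_neg)
    ultimately show "dual_apply f x = dual_apply g x" by (metis dual_apply_linear(2))
  qed
  show "h + f \<le> h + g" if "f \<le> g" using that by (simp add: less_eq_dual_def)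
  show "a *\<^sub>R f \<le> a *\<^sub>R g" if "f \<le> g" "0 \<le> a"
    using that by (simp add: less_eq_dual_def mult_left_mono)
  show "a *\<^sub>R f \<le> b *\<^sub>R f" if "a \<le> b" "0 \<le> f"
    using that by (simp add: less_eq_dual_def mult_right_mono)
  have sup1: "f \<le> sup f g" for f g :: "'a dual"
    unfolding less_eq_dual_def sup_dual_def using pos_dual_upper[of _ _ "f - g"] by fastforce
  have sup2: "g \<le> sup f g" for f g :: "'a dual"
    unfolding less_eq_dual_def sup_dual_def
    using pos_dual_upper[of 0 _ "f - g"] by (simp add: dual_apply_linear)
  have sup3: "sup f g \<le> h" if fh: "f \<le> h" and gh: "g \<le> h" for f g h :: "'a dual"
    unfolding less_eq_dual_def sup_dual_def
  proof (intro allI impI)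
    fix x :: 'a assume x: "0 \<le> x"
    have "dual_apply (pos_dual (f - g)) x \<le> dual_apply (h - g) x"
    proof (rule pos_dual_least[OF x])
      fix y assume y: "0 \<le> y" "y \<le> x"
      have "dual_apply (f - g) y \<le> dual_apply (h - g) y"
        using fh y by (simp add: less_eq_dual_def)
      moreover have "0 \<le> dual_apply (h - g) (x - y)"
        using gh y by (simp add: less_eq_dual_def)
      ultimately show "dual_apply (f - g) y \<le> dual_apply (h - g) x"
        by (simp add: dual_apply_linear del: dual_apply_simps)
    qed
    then show "dual_apply (pos_dual (f - g) + g) x \<le> dual_apply h x" by simp
  qed
  have neg: "- f \<le> - g \<longleftrightarrow> g \<le> f" for f g :: "'a dual" by (simp add: less_eq_dual_def)
  show "f \<le> sup f g" "g \<le> sup f g" by (rule sup1, rule sup2)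
  show "sup g h \<le> f" if "g \<le> f" "h \<le> f" using that by (rule sup3)
  show "inf f g \<le> f" using sup1[of "- f" "- g"] neg[of "sup (- f) (- g)" f]
    by (metis inf_dual_def minus_minus neg)
  show "inf f g \<le> g" using sup2[of "- g" "- f"] by (metis inf_dual_def minus_minus neg)
  show "f \<le> inf g h" if "f \<le> g" "f \<le> h"
    using sup3[of "- g" "- f" "- h"] that by (metis inf_dual_def minus_minus neg)
  show "\<bar>f\<bar> = sup f (- f)" by (rule abs_dual_def)
  show "norm f \<le> norm g" if "\<bar>f\<bar> \<le> \<bar>g\<bar>"
  proof (rule dual_norm_bound)
    fix x :: 'a
    have split: "x = pprt x - pprt (- x)" and abs: "\<bar>x\<bar> = pprt x + pprt (- x)"
      using prts[of x] abs_prts[of x] by (simp_all add: pprt_neg)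
    have "- (\<bar>f\<bar>) \<le> f" "f \<le> \<bar>f\<bar>" "- f \<le> \<bar>f\<bar>"
      using sup1[of f "- f"] sup2[of "- f" f] neg by (metis abs_dual_def minus_minus)+
    then have le: "\<bar>dual_apply f y\<bar> \<le> dual_apply \<bar>f\<bar> y" if "0 \<le> y" for y
      using that unfolding less_eq_dual_def by (auto simp: abs_le_iff)
    have "\<bar>dual_apply f x\<bar> \<le> \<bar>dual_apply f (pprt x)\<bar> + \<bar>dual_apply f (pprt (- x))\<bar>"
      by (subst split, subst dual_apply_linear) (rule abs_triangle_ineq4)
    also have "\<dots> \<le> dual_apply \<bar>f\<bar> \<bar>x\<bar>"
      unfolding abs dual_apply_linear(1) by (intro add_mono le) simp_all
    also have "\<dots> \<le> dual_apply \<bar>g\<bar> \<bar>x\<bar>"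
      using that by (simp add: less_eq_dual_def)
    also have "\<dots> \<le> norm g * norm x"
    proof -
      have "dual_apply (pos_dual (g - - g)) \<bar>x\<bar> \<le> norm g * norm x + dual_apply g \<bar>x\<bar>"
      proof (rule pos_dual_least)
        fix y assume y: "0 \<le> y" "y \<le> \<bar>x\<bar>"
        have "\<bar>y + y - \<bar>x\<bar>\<bar> \<le> \<bar>x\<bar>"
          using y add_mono[of y "\<bar>x\<bar>" y "\<bar>x\<bar>"] by (intro abs_leI) (simp_all add: algebra_simps)
        then have "norm g * norm (y + y - \<bar>x\<bar>) \<le> norm g * norm x"
          by (intro mult_left_mono norm_mono_abs) simp_all
        then have "dual_apply g (y + y - \<bar>x\<bar>) \<le> norm g * norm x"
          using dual_norm_le[of g "y + y - \<bar>x\<bar>"] by linarith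
        then show "dual_apply (g - - g) y \<le> norm g * norm x + dual_apply g \<bar>x\<bar>"
          by (simp add: dual_apply_linear)
      qed simp
      then show ?thesis by (simp add: abs_dual_def sup_dual_def)
    qed
    finally show "\<bar>dual_apply f x\<bar> \<le> norm g * norm x" .
  qed simp
qed

end


section \<open>Weak and weak* convergence\<close>

definition weak_star_null :: "(nat \<Rightarrow> 'a::real_normed_vector dual) \<Rightarrow> bool" where
  "weak_star_null f \<longleftrightarrow> (\<forall>x. (\<lambda>n. f n x) \<longlonglongrightarrow> 0)"

definition weak_topology :: "'a::real_normed_vector topology" where
  "weak_topology = topology_generated_by {dual_apply f -` U | f U. open U}"

definition relatively_weakly_compact :: "'a::real_normed_vector set \<Rightarrow> bool" where
  "relatively_weakly_compact A \<longleftrightarrow> compactin weak_topology (weak_topology closure_of A)"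


section \<open>Properties of Banach lattices\<close>

definition property_d :: "'a::banach_lattice itself \<Rightarrow> bool" where
  "property_d (_ :: 'a itself) \<longleftrightarrow>
     (\<forall>f :: nat \<Rightarrow> 'a dual.
        disjoint_seq f \<and> weak_star_null f \<longrightarrow> weak_star_null (\<lambda>n. \<bar>f n\<bar>))"

definition positive_dual_schur :: "'a::banach_lattice itself \<Rightarrow> bool" where
  "positive_dual_schur (_ :: 'a itself) \<longleftrightarrow>
     (\<forall>f :: nat \<Rightarrow> 'a dual.
        (\<forall>n. 0 \<le> f n) \<and> weak_star_null f \<longrightarrow> (\<lambda>n. norm (f n)) \<longlonglongrightarrow> 0)"


section \<open>Almost limited sets and operators\<close>

text \<open>The supremum is taken in \<^typ>\<open>ennreal\<close>, where the supremum over the empty set is \<open>0\<close>.\<close>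

definition almost_limited_set :: "'a::banach_lattice set \<Rightarrow> bool" where
  "almost_limited_set A \<longleftrightarrow>
     bounded A \<and>
     (\<forall>f :: nat \<Rightarrow> 'a dual. disjoint_seq f \<and> weak_star_null f \<longrightarrow>
        (\<lambda>n. SUP y\<in>A. ennreal \<bar>f n y\<bar>) \<longlonglongrightarrow> 0)"

definition almost_limited :: "('a::banach \<Rightarrow>\<^sub>L 'b::banach_lattice) \<Rightarrow> bool" where
  "almost_limited T \<longleftrightarrow> almost_limited_set (T ` cball 0 1)"

definition weak_almost_limited :: "('a::banach \<Rightarrow>\<^sub>L 'b::banach_lattice) \<Rightarrow> bool" where
  "weak_almost_limited T \<longleftrightarrow>
     (\<forall>A. relatively_weakly_compact A \<longrightarrow> almost_limited_set (T ` A))"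

definition positive_operator :: "('a::banach_lattice \<Rightarrow>\<^sub>L 'b::banach_lattice) \<Rightarrow> bool" where
  "positive_operator T \<longleftrightarrow> (\<forall>x\<ge>0. 0 \<le> T x)"

definition order_bounded_operator :: "('a::banach_lattice \<Rightarrow>\<^sub>L 'b::banach_lattice) \<Rightarrow> bool" where
  "order_bounded_operator T \<longleftrightarrow> (\<forall>a b. \<exists>c d. T ` {a..b} \<subseteq> {c..d})"

end

theory Submission
  imports Defs
begin

text \<open>
  If \<open>F\<close> has the positive dual Schur property and property (d), every bounded operator into \<open>F\<close> is
  almost limited. If the norm of \<open>E\<^sup>*\<close> is order continuous, bounded disjoint positive sequences in
  \<open>E\<close> are weakly null, and a weak almost limited \<open>T\<close> controls them; for order bounded \<open>T\<close> and disjoint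
  weak* null \<open>(f\<^sub>n)\<close> property (d) makes \<open>(\<bar>T\<^sup>*f\<^sub>n\<bar>)\<close> weak* null, so a disjointification of
  Dodds--Fremlin type gives \<open>\<parallel>T\<^sup>*f\<^sub>n\<parallel> \<longlonglongrightarrow> 0\<close>. If both properties fail, there are
  disjoint positive weak* null \<open>g\<^sub>n\<close> in \<open>F\<^sup>*\<close> and positive \<open>y\<^sub>n\<close> in the unit ball of \<open>F\<close> with \<open>g\<^sub>n(y\<^sub>n)\<close>
  bounded away from \<open>0\<close>, and positive \<open>\<psi>\<^sub>n\<close> in \<open>E\<^sup>*\<close>, with norms bounded away from \<open>0\<close> and order bounded partial sums.
  Then \<open>T x = (\<Sum>n. \<psi>\<^sub>n(x) y\<^sub>n)\<close> factors through \<open>\<ell>\<^sub>1\<close>, so by the Schur property of \<open>\<ell>\<^sub>1\<close> it is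
  weak almost limited, but \<open>\<parallel>T\<^sup>*g\<^sub>n\<parallel> \<ge> g\<^sub>n(y\<^sub>n) \<parallel>\<psi>\<^sub>n\<parallel>\<close>.
\<close>

section \<open>Banach lattices\<close>

lemma norm_abs_banach_lattice: "norm \<bar>x\<bar> = norm (x :: 'a::banach_lattice)"
  by (intro antisym norm_mono_abs) simp_all

lemma norm_mono_nonneg: "0 \<le> x \<Longrightarrow> x \<le> y \<Longrightarrow> norm x \<le> norm (y :: 'a::banach_lattice)"
  by (intro norm_mono_abs) (auto intro: order_trans)

lemma pprt_diff_pprt_uminus: "pprt x - pprt (- x) = (x :: 'a::lattice_ab_group_add)"
  using prts[of x] by (simp add: pprt_neg)

lemma pprt_add_pprt_uminus: "pprt x + pprt (- x) = \<bar>x :: 'a::lattice_ab_group_add_abs\<bar>"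
  using abs_prts[of x] by (simp add: pprt_neg)

lemma pprt_le_abs: "pprt x \<le> \<bar>x :: 'a::lattice_ab_group_add_abs\<bar>"
  by (simp add: pprt_def abs_ge_self)

lemma norm_pprt_le: "norm (pprt x) \<le> norm (x :: 'a::banach_lattice)"
  using norm_mono_nonneg[OF zero_le_pprt pprt_le_abs[of x]] by (simp add: norm_abs_banach_lattice)

text \<open>Since \<open>X n\<close> is positive, \<open>pprt (- x)\<close> lies below
  \<open>\<bar>X n - x\<bar>\<close>, so its norm is at most every approximation error.\<close>

lemma nonneg_limit:
  fixes X :: "nat \<Rightarrow> 'a::banach_lattice"
  assumes "X \<longlonglongrightarrow> x" "\<And>n. 0 \<le> X n"
  shows "0 \<le> x"
proof -
  have "norm (pprt (- x)) \<le> norm (X n - x)" for n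
  proof -
    have "- x \<le> X n - x" using assms(2)[of n] by simp
    then have "pprt (- x) \<le> pprt (X n - x)" by (rule pprt_mono)
    also have "\<dots> \<le> \<bar>X n - x\<bar>" by (rule pprt_le_abs)
    finally show ?thesis
      using norm_mono_nonneg[OF zero_le_pprt] norm_abs_banach_lattice by metis
  qed
  moreover have "(\<lambda>n. norm (X n - x)) \<longlonglongrightarrow> 0"
    using assms(1) by (simp add: LIM_zero tendsto_norm_zero)
  ultimately have "norm (pprt (- x)) \<le> 0"
    by (intro LIMSEQ_le_const) auto
  then show ?thesis by (simp add: pprt_neg flip: zero_le_iff_zero_nprt)
qed

section \<open>Disjoint elements\<close>

lemma inf_pprt_pprt_uminus: "inf (pprt x) (pprt (- x)) = (0 :: 'a::lattice_ab_group_add)"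
proof -
  have "inf (pprt x) (pprt (- x)) = pprt (- x) + inf (pprt x - pprt (- x)) 0"
    by (simp add: add_inf_distrib_left)
  also have "\<dots> = pprt (- x) + inf x 0" by (simp add: pprt_diff_pprt_uminus)
  also have "inf x 0 = nprt x" by (simp add: nprt_def)
  finally show ?thesis by (simp add: pprt_neg)
qed

lemma inf_scaleR:
  fixes x y :: "'a::banach_lattice"
  assumes "0 < c"
  shows "c *\<^sub>R inf x y = inf (c *\<^sub>R x) (c *\<^sub>R y)"
proof (rule antisym)
  show "c *\<^sub>R inf x y \<le> inf (c *\<^sub>R x) (c *\<^sub>R y)"
    using assms by (simp add: scaleR_left_mono)
  have "inverse c *\<^sub>R inf (c *\<^sub>R x) (c *\<^sub>R y) \<le> inverse c *\<^sub>R (c *\<^sub>R z)" if "z = x \<or> z = y" for z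
    using assms that by (intro scaleR_left_mono) auto
  then have "inverse c *\<^sub>R inf (c *\<^sub>R x) (c *\<^sub>R y) \<le> inf x y" using assms by simp
  then have "c *\<^sub>R (inverse c *\<^sub>R inf (c *\<^sub>R x) (c *\<^sub>R y)) \<le> c *\<^sub>R inf x y"
    using assms by (intro scaleR_left_mono) auto
  then show "inf (c *\<^sub>R x) (c *\<^sub>R y) \<le> c *\<^sub>R inf x y" using assms by simp
qed

lemma disjoint_mono:
  fixes x y :: "'a::lattice_ab_group_add"
  assumes "inf x y = 0" "0 \<le> x'" "x' \<le> x" "0 \<le> y'" "y' \<le> y"
  shows "inf x' y' = 0"
  by (rule antisym) (use assms inf_mono[of x' x y' y] in auto)

lemma disjoint_scaleR:
  fixes x y :: "'a::banach_lattice"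
  assumes "inf x y = 0" "0 \<le> x" "0 \<le> y" "0 \<le> a" "0 \<le> b"
  shows "inf (a *\<^sub>R x) (b *\<^sub>R y) = 0"
proof (rule disjoint_mono)
  \<comment> \<open>\<open>a + b + 1\<close> is a positive scalar above both \<open>a\<close> and
    \<open>b\<close>; this covers zero scalars, which \<open>inf_scaleR\<close> excludes.\<close>
  have "inf ((a + b + 1) *\<^sub>R x) ((a + b + 1) *\<^sub>R y) = (a + b + 1) *\<^sub>R inf x y"
    by (rule inf_scaleR[symmetric]) (use assms in simp)
  then show "inf ((a + b + 1) *\<^sub>R x) ((a + b + 1) *\<^sub>R y) = 0" using assms(1) by simp
qed (use assms in \<open>auto intro!: scaleR_right_mono scaleR_nonneg_nonneg\<close>)

text \<open>Riesz decomposition splits \<open>inf a (b + c)\<close> into a part below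
  \<open>b\<close> and a part below \<open>c\<close>; both are also below \<open>a\<close>, hence
  below 0.\<close>

lemma disjoint_add:
  fixes a b c :: "'a::lattice_ab_group_add"
  assumes "inf a b = 0" "inf a c = 0" "0 \<le> a" "0 \<le> b" "0 \<le> c"
  shows "inf a (b + c) = 0"
proof (rule antisym)
  have "0 \<le> inf a (b + c)" using assms by simp
  then obtain u v where uv: "inf a (b + c) = u + v" "0 \<le> u" "u \<le> b" "0 \<le> v" "v \<le> c"
    using riesz_decomposition[of "inf a (b + c)" b c] assms by auto
  have "u + v \<le> a" using uv(1) by (metis inf_le1)
  then have "u \<le> a" "v \<le> a"
    using uv by (metis add_increasing2 add_increasing order_refl order_trans)+
  then have "u \<le> inf a b" "v \<le> inf a c" using uv by simp_all
  then show "inf a (b + c) \<le> 0" using uv(1) assms(1,2) by (simp add: add_nonpos_nonpos)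
qed (use assms in simp)

text \<open>For disjoint elements the sum is the supremum, so a common upper bound of the terms also
  bounds their sum.\<close>

lemma sum_disjoint_le:
  fixes u :: "'i \<Rightarrow> 'a::banach_lattice"
  assumes "finite I" "\<And>i. i \<in> I \<Longrightarrow> 0 \<le> u i" "\<And>i. i \<in> I \<Longrightarrow> u i \<le> x" "0 \<le> x"
    and "\<And>i j. i \<in> I \<Longrightarrow> j \<in> I \<Longrightarrow> i \<noteq> j \<Longrightarrow> inf (u i) (u j) = 0"
  shows "sum u I \<le> x"
  using assms
proof (induction I rule: finite_induct)
  case (insert i I)
  \<comment> \<open>The inner induction shows that \<open>u i\<close> is disjoint from whole partial
    sums, not only from single terms.\<close>
  have "inf (u i) (sum u J) = 0" if "J \<subseteq> I" for J
    using finite_subset[OF that \<open>finite I\<close>] that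
  proof (induction J rule: finite_induct)
    case empty
    then show ?case using insert.prems by (simp add: inf_absorb2)
  next
    case (insert j J)
    then have ij: "i \<noteq> j" using \<open>i \<notin> I\<close> by auto
    have "0 \<le> sum u J"
      by (rule sum_nonneg) (use insert.prems \<open>\<And>i'. i' \<in> insert i I \<Longrightarrow> 0 \<le> u i'\<close> in auto)
    then show ?case
      using insert ij \<open>\<And>i'. i' \<in> insert i I \<Longrightarrow> 0 \<le> u i'\<close>
        \<open>\<And>k l. k \<in> insert i I \<Longrightarrow> l \<in> insert i I \<Longrightarrow> k \<noteq> l \<Longrightarrow> inf (u k) (u l) = 0\<close>
      by (simp add: disjoint_add)
  qed
  then have "u i + sum u I = sup (u i) (sum u I)"
    using add_eq_inf_sup[of "u i" "sum u I"] by simp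
  also have "\<dots> \<le> x" using insert by simp
  finally show ?case using insert by simp
qed simp

section \<open>Majorants and disjointification of bounded sequences\<close>

lemma member_le_sum_nonneg:
  fixes u :: "'i \<Rightarrow> 'a::ordered_comm_monoid_add"
  assumes "finite I" "i \<in> I" "\<And>j. j \<in> I \<Longrightarrow> 0 \<le> u j"
  shows "u i \<le> sum u I"
  using sum_mono2[of I "{i}" u] assms by simp

text \<open>Completeness makes the series of the \<open>(1/2) ^ n *\<^sub>R y n\<close> converge. A
  norm bounded sequence thus becomes order bounded after geometric damping.\<close>

lemma ex_geometric_majorant:
  fixes y :: "nat \<Rightarrow> 'a::banach_lattice"
  assumes y: "\<And>n. 0 \<le> y n" "\<And>n. norm (y n) \<le> 1"
  obtains w where "0 \<le> w" "\<And>n. (1/2) ^ n *\<^sub>R y n \<le> w"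
proof -
  define w where "w = (\<Sum>i. (1/2) ^ i *\<^sub>R y i)"
  have "norm (norm ((1/2) ^ i *\<^sub>R y i)) \<le> (1/2) ^ i" for i
    using mult_left_mono[OF y(2), of "(1/2) ^ i" i] by simp
  then have "summable (\<lambda>i. norm ((1/2) ^ i *\<^sub>R y i))"
    using summable_comparison_test'[of "\<lambda>i. (1/2 :: real) ^ i" 0 "\<lambda>i. norm ((1/2) ^ i *\<^sub>R y i)"]
      summable_geometric[of "1/2 :: real"] by simp
  then have sums: "(\<lambda>i. (1/2) ^ i *\<^sub>R y i) sums w"
    unfolding w_def by (rule summable_sums[OF summable_norm_cancel])
  have w_ge: "(1/2) ^ m *\<^sub>R y m \<le> w" for m
  proof -
    \<comment> \<open>Starting the partial sums at \<open>Suc m\<close> terms makes each of them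
      contain the term with index \<open>m\<close>; the closed cone passes the inequality to the
      limit.\<close>
    have "(\<lambda>n. (\<Sum>i<n + Suc m. (1/2) ^ i *\<^sub>R y i) - (1/2) ^ m *\<^sub>R y m) \<longlonglongrightarrow> w - (1/2) ^ m *\<^sub>R y m"
      using sums unfolding sums_def by (intro tendsto_intros LIMSEQ_ignore_initial_segment)
    moreover have "(1/2) ^ m *\<^sub>R y m \<le> (\<Sum>i<n + Suc m. (1/2) ^ i *\<^sub>R y i)" for n
      by (rule member_le_sum_nonneg[where u = "\<lambda>i. (1/2) ^ i *\<^sub>R y i"])
        (use y in \<open>auto intro: scaleR_nonneg_nonneg\<close>)
    ultimately show ?thesis using nonneg_limit by fastforce
  qed
  have "0 \<le> w" using w_ge[of 0] y(1)[of 0] by simp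
  then show ?thesis using w_ge by (rule that)
qed

text \<open>The disjointification trick of Aliprantis and Burkinshaw: up to a small error, \<open>z n\<close> is
  the part of \<open>y (Suc n)\<close> disjoint from all other \<open>y i\<close>.\<close>

lemma ex_disjoint_minorants:
  fixes y :: "nat \<Rightarrow> 'a::banach_lattice"
  assumes y: "\<And>n. 0 \<le> y n" "\<And>n. norm (y n) \<le> 1"
  obtains z w where "0 \<le> w" "\<And>n. 0 \<le> z n" "\<And>n. z n \<le> y (Suc n)"
    "\<And>n. y (Suc n) - z n \<le> 4 ^ n *\<^sub>R (\<Sum>i\<le>n. y i) + (1/2) ^ n *\<^sub>R w"
    "\<And>n m. n \<noteq> m \<Longrightarrow> inf (z n) (z m) = 0"
proof -
  obtain w where w_nonneg: "0 \<le> w" and w_ge: "\<And>n. (1/2) ^ n *\<^sub>R y n \<le> w"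
    using ex_geometric_majorant[of y, OF y] by blast
  \<comment> \<open>Subtracting \<open>4 ^ n\<close> times the earlier terms removes the overlap
    with them; subtracting \<open>(1/2) ^ n *\<^sub>R w\<close> removes the overlap with the later
    ones.\<close>
  define q where "q n = y (Suc n) - 4 ^ n *\<^sub>R (\<Sum>i\<le>n. y i) - (1/2) ^ n *\<^sub>R w" for n
  define z where "z n = pprt (q n)" for n
  have z_nonneg: "0 \<le> z n" for n unfolding z_def by simp
  have sum_nn: "0 \<le> (4::real) ^ n *\<^sub>R (\<Sum>i\<le>n. y i)" for n
    using y by (intro scaleR_nonneg_nonneg sum_nonneg) auto
  have w2: "0 \<le> (1/2 :: real) ^ n *\<^sub>R w" for n using w_nonneg by (intro scaleR_nonneg_nonneg) auto
  have z_le: "z n \<le> y (Suc n)" for n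
  proof -
    have "q n \<le> y (Suc n)"
      using sum_nn[of n] w2[of n] unfolding q_def by (simp add: diff_le_eq add_increasing2)
    from pprt_mono[OF this] show ?thesis using y(1) unfolding z_def by simp
  qed
  have ge: "x \<le> pprt x" for x :: 'a unfolding pprt_def by simp
  have disj: "inf (z n) (z m) = 0" if "n < m" for n m
  proof -
    \<comment> \<open>Up to positive factors, \<open>z m\<close> will lie below the positive part
      and \<open>z n\<close> below the negative part of \<open>v\<close>, and these are
      disjoint.\<close>
    define v where "v = y (Suc m) - 4 ^ m *\<^sub>R y (Suc n)"
    have "y (Suc n) \<le> (\<Sum>i\<le>m. y i)"
      using y that by (intro member_le_sum_nonneg[where u = y]) auto
    then have "(4::real) ^ m *\<^sub>R y (Suc n) \<le> 4 ^ m *\<^sub>R (\<Sum>i\<le>m. y i)"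
      by (intro scaleR_left_mono) auto
    then have "y (Suc m) - 4 ^ m *\<^sub>R (\<Sum>i\<le>m. y i) - (1/2) ^ m *\<^sub>R w \<le> v - 0"
      unfolding v_def using w2[of m] by (intro diff_mono order_refl)
    then have "y (Suc m) - 4 ^ m *\<^sub>R (\<Sum>i\<le>m. y i) - (1/2) ^ m *\<^sub>R w \<le> v" by simp
    then have zm: "z m \<le> pprt v" unfolding z_def q_def by (rule pprt_mono)
    \<comment> \<open>From \<open>n < m\<close> follows \<open>n + Suc m \<le> 2 * m\<close>, so
      \<open>4 ^ m\<close> absorbs both \<open>(1/2) ^ n\<close> and the factor
      \<open>(1/2) ^ Suc m\<close> with which \<open>w\<close> dominates
      \<open>y (Suc m)\<close>.\<close>
    have c: "(1::real) \<le> 4 ^ m * ((1/2) ^ n * (1/2) ^ Suc m)"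
    proof -
      have "(4::real) ^ m = 2 ^ m * 2 ^ m" by (simp flip: power_mult_distrib)
      moreover have "(2::real) ^ Suc n \<le> 2 ^ m" using that by (intro power_increasing) auto
      ultimately show ?thesis by (simp add: field_simps)
    qed
    have "1 *\<^sub>R y (Suc m) \<le> (4 ^ m * ((1/2) ^ n * (1/2) ^ Suc m)) *\<^sub>R y (Suc m)"
      using c y by (intro scaleR_right_mono) auto
    also have "\<dots> = 4 ^ m *\<^sub>R (1/2) ^ n *\<^sub>R ((1/2) ^ Suc m *\<^sub>R y (Suc m))" by simp
    also have "\<dots> \<le> 4 ^ m *\<^sub>R (1/2) ^ n *\<^sub>R w"
      using w_ge[of "Suc m"] by (intro scaleR_left_mono) auto
    finally have "4 ^ m *\<^sub>R (y (Suc n) - (1/2) ^ n *\<^sub>R w) \<le> - v"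
      unfolding v_def by (simp add: scaleR_diff_right algebra_simps)
    moreover have "(4::real) ^ m *\<^sub>R (y (Suc n) - 4 ^ n *\<^sub>R (\<Sum>i\<le>n. y i) - (1/2) ^ n *\<^sub>R w)
        \<le> 4 ^ m *\<^sub>R (y (Suc n) - (1/2) ^ n *\<^sub>R w)"
      using sum_nn[of n] by (intro scaleR_left_mono) (auto simp: algebra_simps)
    ultimately have "(4::real) ^ m *\<^sub>R q n \<le> - v" unfolding q_def by (rule order_trans[rotated])
    also have "\<dots> \<le> pprt (- v)" by (rule ge)
    finally have "inverse (4 ^ m) *\<^sub>R ((4::real) ^ m *\<^sub>R q n) \<le> inverse (4 ^ m) *\<^sub>R pprt (- v)"
      by (intro scaleR_left_mono) auto
    then have "q n \<le> inverse (4 ^ m) *\<^sub>R pprt (- v)" by simp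
    then have zn: "z n \<le> inverse (4 ^ m) *\<^sub>R pprt (- v)"
      unfolding z_def pprt_def[of "q n"] by (simp add: scaleR_nonneg_nonneg)
    have "inf (inverse (4 ^ m) *\<^sub>R pprt (- v)) (1 *\<^sub>R pprt v) = 0"
      by (rule disjoint_scaleR) (simp_all add: inf_pprt_pprt_uminus inf.commute)
    then show ?thesis using disjoint_mono[OF _ z_nonneg zn z_nonneg, of "pprt v" m] zm by simp
  qed
  show ?thesis
  proof
    show "y (Suc n) - z n \<le> 4 ^ n *\<^sub>R (\<Sum>i\<le>n. y i) + (1/2) ^ n *\<^sub>R w" for n
      using ge[of "q n"] unfolding z_def q_def by (simp add: algebra_simps)
    show "inf (z n) (z m) = 0" if "n \<noteq> m" for n m
      using disj[of n m] disj[of m n] that by (auto simp: inf.commute nat_neq_iff)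
  qed (rule w_nonneg z_nonneg z_le)+
qed

section \<open>Functionals on a Banach lattice\<close>

lemma dual_apply_mono: "0 \<le> f \<Longrightarrow> x \<le> y \<Longrightarrow> dual_apply f x \<le> dual_apply f y"
  for f :: "'a::banach_lattice dual"
  unfolding less_eq_dual_def using dual_apply_linear(2)[of f y x]
  by (metis diff_ge_0_iff_ge dual_apply_simps(1))

lemma dual_apply_nonneg: "0 \<le> f \<Longrightarrow> 0 \<le> x \<Longrightarrow> 0 \<le> dual_apply f x"
  for f :: "'a::banach_lattice dual"
  by (simp add: less_eq_dual_def)

lemma dual_leD: "f \<le> g \<Longrightarrow> 0 \<le> x \<Longrightarrow> dual_apply f x \<le> dual_apply g x"
  for f :: "'a::banach_lattice dual"
  by (simp add: less_eq_dual_def)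

lemma dual_apply_sum: "dual_apply f (sum u I) = (\<Sum>i\<in>I. dual_apply f (u i))"
  by (rule linear_sum[OF bounded_linear.linear[OF bounded_linear_dual_apply]])

lemma dual_sum_apply: "dual_apply (sum f I) x = (\<Sum>i\<in>I. dual_apply (f i) x)"
  by (induction I rule: infinite_finite_induct) simp_all

lemma abs_dual_apply_le: "\<bar>dual_apply f x\<bar> \<le> dual_apply \<bar>f\<bar> \<bar>x\<bar>"
  for f :: "'a::banach_lattice dual"
proof -
  have le: "\<bar>dual_apply f y\<bar> \<le> dual_apply \<bar>f\<bar> y" if "0 \<le> y" for y
    using dual_leD[OF abs_ge_self[of f] that] dual_leD[OF abs_ge_minus_self[of f] that] by simp
  have "dual_apply f x = dual_apply f (pprt x) - dual_apply f (pprt (- x))"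
    by (metis dual_apply_linear(2) pprt_diff_pprt_uminus)
  moreover have "dual_apply \<bar>f\<bar> \<bar>x\<bar> = dual_apply \<bar>f\<bar> (pprt x) + dual_apply \<bar>f\<bar> (pprt (- x))"
    by (metis dual_apply_linear(1) pprt_add_pprt_uminus)
  ultimately show ?thesis using le[of "pprt x"] le[of "pprt (- x)"] by simp
qed

text \<open>The upper half of the Riesz-Kantorovich formula for the modulus. By definition
  \<open>\<bar>f\<bar>\<close> is \<open>pos_dual (f - - f) - f\<close>, and \<open>y\<close> in
  \<open>{0..x}\<close> corresponds to \<open>y + y - x\<close> in \<open>{- x..x}\<close>.\<close>

lemma abs_dual_apply_least:
  fixes f :: "'a::banach_lattice dual"
  assumes "0 \<le> x" "\<And>y. \<bar>y\<bar> \<le> x \<Longrightarrow> dual_apply f y \<le> c"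
  shows "dual_apply \<bar>f\<bar> x \<le> c"
proof -
  have "dual_apply (pos_dual (f - - f)) x \<le> c + dual_apply f x"
  proof (rule pos_dual_least[OF assms(1)])
    fix y assume y: "0 \<le> y" "y \<le> x"
    have "\<bar>y + y - x\<bar> \<le> x"
      using y add_mono[of y x y x] by (intro abs_leI) (simp_all add: algebra_simps)
    from assms(2)[OF this] show "dual_apply (f - - f) y \<le> c + dual_apply f x"
      by (simp add: dual_apply_linear)
  qed
  then show ?thesis by (simp add: abs_dual_def sup_dual_def)
qed

text \<open>The factor 2 pays for restricting to positive vectors: a general vector is a difference
  of two positive ones of no larger norm.\<close>

lemma norm_dual_witness:
  fixes f :: "'a::banach_lattice dual"
  assumes "2 * c < norm f" "0 \<le> c"
  obtains x where "0 \<le> x" "norm x \<le> 1" "c < \<bar>dual_apply f x\<bar>"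
proof (rule ccontr)
  note witness = that
  assume "\<not> thesis"
  then have small: "\<bar>dual_apply f x\<bar> \<le> c" if "0 \<le> x" "norm x \<le> 1" for x
    using that witness \<open>\<not> thesis\<close> by force
  have le: "\<bar>dual_apply f x\<bar> \<le> c * norm x" if "0 \<le> x" for x
  proof (cases "x = 0")
    case False
    have "\<bar>dual_apply f (inverse (norm x) *\<^sub>R x)\<bar> \<le> c"
      using False that by (intro small) (simp_all add: scaleR_nonneg_nonneg)
    then show ?thesis using False by (simp add: dual_apply_linear abs_mult field_simps)
  qed (simp add: dual_apply_linear)
  have "norm f \<le> 2 * c"
  proof (rule dual_norm_bound)
    fix x :: 'a
    have "dual_apply f x = dual_apply f (pprt x) - dual_apply f (pprt (- x))"
      by (metis dual_apply_linear(2) pprt_diff_pprt_uminus)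
    moreover have "c * norm (pprt x) \<le> c * norm x" "c * norm (pprt (- x)) \<le> c * norm x"
      using assms(2) norm_pprt_le[of x] norm_pprt_le[of "- x"] by (auto intro: mult_left_mono)
    ultimately show "\<bar>dual_apply f x\<bar> \<le> 2 * c * norm x"
      using le[of "pprt x"] le[of "pprt (- x)"] by simp
  qed (use assms in simp)
  then show False using assms by simp
qed

section \<open>Functionals determined by their values on the positive cone\<close>

lemma ex_dual_extends_cone:
  fixes p :: "'a::banach_lattice \<Rightarrow> real"
  assumes add: "\<And>x y. 0 \<le> x \<Longrightarrow> 0 \<le> y \<Longrightarrow> p (x + y) = p x + p y"
    and scale: "\<And>c x. 0 < c \<Longrightarrow> 0 \<le> x \<Longrightarrow> p (c *\<^sub>R x) = c * p x"
    and nonneg: "\<And>x. 0 \<le> x \<Longrightarrow> 0 \<le> p x" and le: "\<And>x. 0 \<le> x \<Longrightarrow> p x \<le> C * norm x"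
  shows "\<exists>g. \<forall>x\<ge>0. dual_apply g x = p x"
proof -
  have p_zero: "p 0 = 0" using add[of 0 0] by simp
  define h where "h x = p (pprt x) - p (pprt (- x))" for x
  \<comment> \<open>The value of \<open>h\<close> does not depend on how a vector is written as a
    difference of positive ones; linearity of \<open>h\<close> follows from this.\<close>
  have h_diff: "h (a - b) = p a - p b" if ab: "0 \<le> a" "0 \<le> b" for a b
  proof -
    have "pprt (a - b) + b = a + pprt (- (a - b))"
      using pprt_diff_pprt_uminus[of "a - b"] by (simp add: algebra_simps)
    then have "p (pprt (a - b)) + p b = p a + p (pprt (- (a - b)))"
      using add ab by (metis zero_le_pprt)
    then show ?thesis unfolding h_def by simp
  qed
  have "bounded_linear h"
  proof (rule bounded_linear_intro)
    fix x y :: 'a and r :: real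
    have "x + y = (pprt x + pprt y) - (pprt (- x) + pprt (- y))"
      by (metis pprt_diff_pprt_uminus add_diff_add)
    then show "h (x + y) = h x + h y"
      by (simp only: h_diff add_nonneg_nonneg zero_le_pprt add) (simp add: h_def)
    consider "r = 0" | "0 < r" | "0 < - r" by linarith
    then show "h (r *\<^sub>R x) = r *\<^sub>R h x"
    proof cases
      case 2
      have "r *\<^sub>R x = r *\<^sub>R pprt x - r *\<^sub>R pprt (- x)"
        by (metis pprt_diff_pprt_uminus scaleR_diff_right)
      moreover have "h \<dots> = p (r *\<^sub>R pprt x) - p (r *\<^sub>R pprt (- x))"
        using 2 by (intro h_diff scaleR_nonneg_nonneg) auto
      ultimately show ?thesis
        using 2 by (simp only: scale zero_le_pprt) (simp add: h_def algebra_simps)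
    next
      case 3
      have "r *\<^sub>R x = (- r) *\<^sub>R pprt (- x) - (- r) *\<^sub>R pprt x"
        by (metis pprt_diff_pprt_uminus minus_diff_eq scaleR_diff_right scaleR_minus_left)
      moreover have "h \<dots> = p ((- r) *\<^sub>R pprt (- x)) - p ((- r) *\<^sub>R pprt x)"
        using 3 by (intro h_diff scaleR_nonneg_nonneg) auto
      ultimately show ?thesis
        using 3 by (simp only: scale zero_le_pprt) (simp add: h_def algebra_simps)
    qed (simp add: h_def p_zero)
    have C: "p (pprt z) \<le> \<bar>C\<bar> * norm z" for z
    proof -
      have "C * norm (pprt z) \<le> \<bar>C\<bar> * norm z"
        using norm_pprt_le[of z] by (intro mult_mono) auto
      then show ?thesis using le[of "pprt z"] by simp
    qed
    show "norm (h x) \<le> norm x * \<bar>C\<bar>"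
      unfolding h_def using nonneg[of "pprt x"] nonneg[of "pprt (- x)"] C[of x] C[of "- x"]
      by (simp add: mult.commute abs_le_iff)
  qed
  moreover have "h x = p x" if "0 \<le> x" for x
    using h_diff[of x 0] that p_zero by simp
  ultimately show ?thesis using ex_dual_apply[of h] by metis
qed

text \<open>The pointwise infimum over \<open>D\<close> is additive on the cone because
  \<open>D\<close> is directed downwards. The last conclusion identifies \<open>h x\<close> with the
  infimum of the values at \<open>x\<close>.\<close>

lemma directed_inf_dual:
  fixes D :: "'a::banach_lattice dual set"
  assumes "D \<noteq> {}" "\<And>f g. f \<in> D \<Longrightarrow> g \<in> D \<Longrightarrow> \<exists>h\<in>D. h \<le> f \<and> h \<le> g" "\<And>f. f \<in> D \<Longrightarrow> 0 \<le> f"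
  obtains h where "0 \<le> h" "\<And>f. f \<in> D \<Longrightarrow> h \<le> f"
    "\<And>x c. 0 \<le> x \<Longrightarrow> (\<And>f. f \<in> D \<Longrightarrow> c \<le> dual_apply f x) \<Longrightarrow> c \<le> dual_apply h x"
proof -
  define p where "p x = (INF f\<in>D. dual_apply f x)" for x
  have bdd: "bdd_below ((\<lambda>f. dual_apply f x) ` D)" if "0 \<le> x" for x
    using assms(3) that by (intro bdd_belowI2[where m = 0]) (auto intro: dual_apply_nonneg)
  have lower: "p x \<le> dual_apply f x" if "0 \<le> x" "f \<in> D" for x f
    unfolding p_def by (rule cINF_lower[OF bdd]) (use that in auto)
  have greatest: "c \<le> p x" if "\<And>f. f \<in> D \<Longrightarrow> c \<le> dual_apply f x" for x c
    unfolding p_def by (rule cINF_greatest) (use that assms(1) in auto)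
  obtain f0 where f0: "f0 \<in> D" using assms(1) by auto
  have "\<exists>h. \<forall>x\<ge>0. dual_apply h x = p x"
  proof (rule ex_dual_extends_cone)
    fix x y :: 'a assume xy: "0 \<le> x" "0 \<le> y"
    show "p (x + y) = p x + p y"
    proof (rule antisym)
      have "p (x + y) - dual_apply f x \<le> dual_apply g y" if fg: "f \<in> D" "g \<in> D" for f g
      proof -
        obtain h where h: "h \<in> D" "h \<le> f" "h \<le> g" using assms(2) fg by blast
        have "p (x + y) \<le> dual_apply h x + dual_apply h y"
          using lower[of "x + y" h] xy h by (simp add: dual_apply_linear)
        then show ?thesis using dual_leD[OF h(2) xy(1)] dual_leD[OF h(3) xy(2)] by simp
      qed
      then have "p (x + y) - dual_apply f x \<le> p y" if "f \<in> D" for f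
        using that by (intro greatest) auto
      then have "p (x + y) - p y \<le> p x" by (intro greatest) (simp add: algebra_simps)
      then show "p (x + y) \<le> p x + p y" by simp
      show "p x + p y \<le> p (x + y)"
        using lower xy by (intro greatest) (simp add: dual_apply_linear add_mono)
    qed
  next
    fix c :: real and x :: 'a assume c: "0 < c" and x: "0 \<le> x"
    show "p (c *\<^sub>R x) = c * p x"
    proof (rule antisym)
      have "p (c *\<^sub>R x) / c \<le> p x"
        using lower[of "c *\<^sub>R x"] c x
        by (intro greatest) (simp add: dual_apply_linear scaleR_nonneg_nonneg field_simps)
      then show "p (c *\<^sub>R x) \<le> c * p x" using c by (simp add: field_simps)
      show "c * p x \<le> p (c *\<^sub>R x)"
        using lower[OF x] c by (intro greatest) (simp add: dual_apply_linear)
    qed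
  next
    fix x :: 'a assume x: "0 \<le> x"
    show "0 \<le> p x" using assms(3) x by (intro greatest) (auto intro: dual_apply_nonneg)
    show "p x \<le> norm f0 * norm x" using lower[OF x f0] dual_norm_le[of f0 x] by simp
  qed
  then obtain h where h: "\<And>x. 0 \<le> x \<Longrightarrow> dual_apply h x = p x" by blast
  show ?thesis
  proof
    show "0 \<le> h" using greatest[of 0] assms(3) unfolding less_eq_dual_def
      by (auto simp: h intro!: greatest)
    show "h \<le> f" if "f \<in> D" for f using lower that by (simp add: less_eq_dual_def h)
    show "c \<le> dual_apply h x" if "0 \<le> x" "\<And>f. f \<in> D \<Longrightarrow> c \<le> dual_apply f x" for x c
      using that greatest by (simp add: h)
  qed
qed

section \<open>Band parts of a positive functional\<close>

text \<open>The restriction of \<open>f\<close> to the band generated by \<open>u\<close>, extended by zero to its disjoint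
  complement.\<close>

definition band_part :: "'a::banach_lattice dual \<Rightarrow> 'a \<Rightarrow> 'a dual" where
  "band_part f u = (SOME g. \<forall>x\<ge>0. dual_apply g x = (SUP k\<in>{0..}. dual_apply f (inf x (k *\<^sub>R u))))"

context
  fixes f :: "'a::banach_lattice dual" and u :: 'a
  assumes f: "0 \<le> f" and u: "0 \<le> u"
begin

lemma bdd_above_band_part: "bdd_above ((\<lambda>k::real. dual_apply f (inf x (k *\<^sub>R u))) ` {0..})"
  using f by (intro bdd_aboveI2[where M = "dual_apply f x"]) (auto intro: dual_apply_mono)

text \<open>Additivity of the supremum on the cone makes the choice in \<open>band_part\<close>
  succeed. For one inequality the truncation of \<open>x + y\<close> is split by Riesz
  decomposition; for the other the levels \<open>k\<close> and \<open>l\<close> are added.\<close>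

lemma band_part_apply:
  assumes "0 \<le> x"
  shows "dual_apply (band_part f u) x = (SUP k\<in>{0..}. dual_apply f (inf x (k *\<^sub>R u)))"
proof -
  define p where "p x = (SUP k\<in>{0::real..}. dual_apply f (inf x (k *\<^sub>R u)))" for x
  have upper: "dual_apply f (inf x (k *\<^sub>R u)) \<le> p x" if "0 \<le> k" for x k
    unfolding p_def by (rule cSUP_upper[OF _ bdd_above_band_part]) (use that in auto)
  have least: "p x \<le> c" if "\<And>k. 0 \<le> k \<Longrightarrow> dual_apply f (inf x (k *\<^sub>R u)) \<le> c" for x c
    unfolding p_def by (rule cSUP_least) (use that in auto)
  have "\<exists>h. \<forall>x\<ge>0. dual_apply h x = p x"
  proof (rule ex_dual_extends_cone)
    fix x y :: 'a assume xy: "0 \<le> x" "0 \<le> y"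
    show "p (x + y) = p x + p y"
    proof (rule antisym)
      show "p (x + y) \<le> p x + p y"
      proof (rule least)
        fix k :: real assume k: "0 \<le> k"
        have ku: "0 \<le> k *\<^sub>R u" using k u by (simp add: scaleR_nonneg_nonneg)
        have "inf (x + y) (k *\<^sub>R u) \<le> x + y" by simp
        moreover have "0 \<le> inf (x + y) (k *\<^sub>R u)" using xy ku by simp
        ultimately obtain v w where vw: "inf (x + y) (k *\<^sub>R u) = v + w"
          "0 \<le> v" "v \<le> x" "0 \<le> w" "w \<le> y"
          using riesz_decomposition[of _ x y] xy by metis
        have "v + w \<le> k *\<^sub>R u" using vw(1) by (metis inf_le2)
        then have "v \<le> k *\<^sub>R u" "w \<le> k *\<^sub>R u"
          using vw by (metis add_increasing2 add_increasing order_refl order_trans)+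
        then have "dual_apply f v \<le> dual_apply f (inf x (k *\<^sub>R u))"
          "dual_apply f w \<le> dual_apply f (inf y (k *\<^sub>R u))"
          using vw by (auto intro!: dual_apply_mono[OF f])
        then show "dual_apply f (inf (x + y) (k *\<^sub>R u)) \<le> p x + p y"
          using upper[OF k, of x] upper[OF k, of y] by (simp add: vw(1) dual_apply_linear)
      qed
      have "dual_apply f (inf x (k *\<^sub>R u)) + dual_apply f (inf y (l *\<^sub>R u)) \<le> p (x + y)"
        if kl: "0 \<le> k" "0 \<le> l" for k l
      proof -
        have "inf x (k *\<^sub>R u) + inf y (l *\<^sub>R u) \<le> inf (x + y) ((k + l) *\<^sub>R u)"
          by (auto simp: scaleR_add_left intro!: add_mono)
        from dual_apply_mono[OF f this] show ?thesis
          using upper[of "k + l" "x + y"] kl by (simp add: dual_apply_linear)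
      qed
      then have "p x \<le> p (x + y) - dual_apply f (inf y (l *\<^sub>R u))" if "0 \<le> l" for l
        using that by (intro least) (simp add: algebra_simps)
      then have "p y \<le> p (x + y) - p x" by (intro least) (simp add: algebra_simps)
      then show "p x + p y \<le> p (x + y)" by simp
    qed
  next
    fix c :: real and x :: 'a assume c: "0 < c" and x: "0 \<le> x"
    have eq: "inf (c *\<^sub>R x) (k *\<^sub>R u) = c *\<^sub>R inf x ((k / c) *\<^sub>R u)" for k
      using c by (simp add: inf_scaleR)
    show "p (c *\<^sub>R x) = c * p x"
    proof (rule antisym)
      show "p (c *\<^sub>R x) \<le> c * p x"
        using c by (intro least) (simp add: eq dual_apply_linear upper)
      have "p x \<le> p (c *\<^sub>R x) / c"
      proof (rule least)
        fix k :: real assume "0 \<le> k"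
        then show "dual_apply f (inf x (k *\<^sub>R u)) \<le> p (c *\<^sub>R x) / c"
          using upper[of "c * k" "c *\<^sub>R x"] c by (simp add: eq dual_apply_linear field_simps)
      qed
      then show "c * p x \<le> p (c *\<^sub>R x)" using c by (simp add: field_simps)
    qed
  next
    fix x :: 'a assume x: "0 \<le> x"
    show "0 \<le> p x" using upper[of 0 x] x by (simp add: inf_absorb2 dual_apply_linear)
    show "p x \<le> norm f * norm x"
    proof (rule least)
      fix k :: real
      have "dual_apply f (inf x (k *\<^sub>R u)) \<le> dual_apply f x" by (rule dual_apply_mono[OF f]) simp
      then show "dual_apply f (inf x (k *\<^sub>R u)) \<le> norm f * norm x"
        using dual_norm_le[of f x] by simp
    qed
  qed
  from someI_ex[OF this[unfolded p_def], folded band_part_def] show ?thesis using assms by blast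
qed

lemma band_part_upper: "0 \<le> x \<Longrightarrow> 0 \<le> k \<Longrightarrow> dual_apply f (inf x (k *\<^sub>R u)) \<le> dual_apply (band_part f u) x"
  unfolding band_part_apply by (rule cSUP_upper[OF _ bdd_above_band_part]) simp

lemma band_part_least:
  "0 \<le> x \<Longrightarrow> (\<And>k. 0 \<le> k \<Longrightarrow> dual_apply f (inf x (k *\<^sub>R u)) \<le> c) \<Longrightarrow> dual_apply (band_part f u) x \<le> c"
  unfolding band_part_apply by (rule cSUP_least) auto

lemma band_part_approx:
  assumes "0 \<le> x" "0 < e"
  obtains k where "0 \<le> k" "dual_apply (band_part f u) x \<le> dual_apply f (inf x (k *\<^sub>R u)) + e"
proof (rule ccontr)
  note witness = that
  assume "\<not> thesis"
  then have "dual_apply f (inf x (k *\<^sub>R u)) \<le> dual_apply (band_part f u) x - e" if "0 \<le> k" for k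
    using that witness \<open>\<not> thesis\<close> by force
  from band_part_least[OF assms(1) this] assms(2) show False by simp
qed

lemma band_part_nonneg: "0 \<le> band_part f u"
  unfolding less_eq_dual_def using band_part_upper[of _ 0]
  by (auto simp: inf_absorb2 dual_apply_linear)

lemma band_part_le: "band_part f u \<le> f"
  unfolding less_eq_dual_def by (auto intro!: band_part_least dual_apply_mono[OF f])

lemma band_part_self: "dual_apply (band_part f u) u = dual_apply f u"
  using band_part_upper[of u 1] dual_leD[OF band_part_le u] u by simp

end

text \<open>Cut \<open>x\<close> at \<open>x' = inf x (k *\<^sub>R u)\<close>. The first band part
  is at most \<open>e\<close> on \<open>x - x'\<close>, the second vanishes on \<open>x'\<close>, so
  their infimum is at most \<open>e\<close> at \<open>x\<close>.\<close>

lemma band_part_disjoint: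
  fixes f g :: "'a::banach_lattice dual"
  assumes "0 \<le> f" "0 \<le> u" "0 \<le> g" "0 \<le> v" "inf u v = 0"
  shows "inf (band_part f u) (band_part g v) = 0"
proof (rule antisym)
  show "inf (band_part f u) (band_part g v) \<le> 0" (is "?t \<le> 0")
    unfolding less_eq_dual_def
  proof (intro allI impI)
    fix x :: 'a assume x: "0 \<le> x"
    have "dual_apply ?t x \<le> 0 + e" if "0 < e" for e
    proof -
      obtain k where k: "0 \<le> k" "dual_apply (band_part f u) x \<le> dual_apply f (inf x (k *\<^sub>R u)) + e"
        using band_part_approx[OF assms(1,2) x \<open>0 < e\<close>] .
      define x' where "x' = inf x (k *\<^sub>R u)"
      have x': "0 \<le> x'" "x' \<le> x" using x k assms by (auto simp: x'_def scaleR_nonneg_nonneg)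
      have "dual_apply f x' \<le> dual_apply (band_part f u) x'"
        using band_part_upper[OF assms(1,2) x'(1) k(1)] by (simp add: x'_def inf.assoc)
      moreover have "dual_apply ?t (x - x') \<le> dual_apply (band_part f u) (x - x')"
        using x' by (intro dual_leD) auto
      moreover have "dual_apply ?t x' \<le> dual_apply (band_part g v) x'"
        using x' by (intro dual_leD) auto
      moreover have "dual_apply (band_part g v) x' \<le> 0"
      proof (rule band_part_least[OF assms(3,4) x'(1)])
        fix l :: real assume l: "0 \<le> l"
        have "inf (k *\<^sub>R u) (l *\<^sub>R v) = 0" by (rule disjoint_scaleR) (use assms k l in auto)
        then have "inf x' (l *\<^sub>R v) = 0"
          by (rule disjoint_mono) (use x' l assms in \<open>auto simp: x'_def scaleR_nonneg_nonneg\<close>)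
        then show "dual_apply g (inf x' (l *\<^sub>R v)) \<le> 0" by (simp add: dual_apply_linear)
      qed
      ultimately show ?thesis using k(2) unfolding x'_def[symmetric] by (simp add: dual_apply_linear)
    qed
    then have "dual_apply ?t x \<le> 0" by (rule field_le_epsilon)
    then show "dual_apply ?t x \<le> dual_apply 0 x" by simp
  qed
qed (use assms band_part_nonneg in auto)

text \<open>At \<open>x\<close>, each band part is nearly the value of \<open>f\<close> at a
  truncation \<open>inf x (k i *\<^sub>R u i)\<close>; these truncations are disjoint and below
  \<open>x\<close>, so their sum is below \<open>x\<close>.\<close>

lemma sum_band_part_le:
  fixes f :: "'a::banach_lattice dual"
  assumes "0 \<le> f" "finite I" "\<And>i. i \<in> I \<Longrightarrow> 0 \<le> u i"
    "\<And>i j. i \<in> I \<Longrightarrow> j \<in> I \<Longrightarrow> i \<noteq> j \<Longrightarrow> inf (u i) (u j) = 0"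
  shows "(\<Sum>i\<in>I. band_part f (u i)) \<le> f"
  unfolding less_eq_dual_def
proof (intro allI impI)
  fix x :: 'a assume x: "0 \<le> x"
  have "(\<Sum>i\<in>I. dual_apply (band_part f (u i)) x) \<le> dual_apply f x + e" if "0 < e" for e
  proof -
    \<comment> \<open>The \<open>+ 1\<close> keeps \<open>d\<close> positive for empty
      \<open>I\<close>.\<close>
    define d where "d = e / (card I + 1)"
    have d: "0 < d" "card I * d \<le> e" using that by (simp_all add: d_def field_simps)
    have "\<exists>k\<ge>0. dual_apply (band_part f (u i)) x \<le> dual_apply f (inf x (k *\<^sub>R u i)) + d" if "i \<in> I" for i
      using band_part_approx[OF assms(1) assms(3)[OF that] x d(1)] by blast
    then obtain k where k: "\<And>i. i \<in> I \<Longrightarrow> 0 \<le> k i"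
      "\<And>i. i \<in> I \<Longrightarrow> dual_apply (band_part f (u i)) x \<le> dual_apply f (inf x (k i *\<^sub>R u i)) + d"
      by metis
    have "(\<Sum>i\<in>I. dual_apply (band_part f (u i)) x) \<le> (\<Sum>i\<in>I. dual_apply f (inf x (k i *\<^sub>R u i)) + d)"
      by (intro sum_mono k)
    also have "\<dots> = dual_apply f (\<Sum>i\<in>I. inf x (k i *\<^sub>R u i)) + card I * d"
      by (simp add: dual_apply_sum sum.distrib)
    also have "dual_apply f (\<Sum>i\<in>I. inf x (k i *\<^sub>R u i)) \<le> dual_apply f x"
    proof (intro dual_apply_mono[OF assms(1)] sum_disjoint_le)
      fix i j assume ij: "i \<in> I" "j \<in> I" "i \<noteq> j"
      have "inf (k i *\<^sub>R u i) (k j *\<^sub>R u j) = 0" by (rule disjoint_scaleR) (use assms k ij in auto)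
      then show "inf (inf x (k i *\<^sub>R u i)) (inf x (k j *\<^sub>R u j)) = 0"
        by (rule disjoint_mono) (use x k assms ij in \<open>auto simp: scaleR_nonneg_nonneg\<close>)
    qed (use assms x k in \<open>auto simp: scaleR_nonneg_nonneg\<close>)
    finally show ?thesis using d by simp
  qed
  then show "dual_apply (\<Sum>i\<in>I. band_part f (u i)) x \<le> dual_apply f x"
    unfolding dual_sum_apply by (rule field_le_epsilon)
qed

section \<open>Weak* null sequences and disjoint witnesses\<close>

lemma weak_star_null_subseq: "weak_star_null f \<Longrightarrow> strict_mono r \<Longrightarrow> weak_star_null (\<lambda>n. f (r n))"
  unfolding weak_star_null_def using LIMSEQ_subseq_LIMSEQ[unfolded o_def] by fast

lemma weak_star_null_dominated:
  fixes f g :: "nat \<Rightarrow> 'a::banach_lattice dual"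
  assumes "weak_star_null g" "\<And>n x. 0 \<le> x \<Longrightarrow> dual_apply \<bar>f n\<bar> x \<le> dual_apply (g n) x"
  shows "weak_star_null f"
  unfolding weak_star_null_def
proof
  fix x :: 'a
  have "(\<lambda>n. dual_apply (g n) \<bar>x\<bar>) \<longlonglongrightarrow> 0" using assms(1) by (simp add: weak_star_null_def)
  then show "(\<lambda>n. dual_apply (f n) x) \<longlonglongrightarrow> 0"
    by (rule Lim_null_comparison[rotated])
      (use abs_dual_apply_le assms(2)[of "\<bar>x\<bar>"] in \<open>auto intro!: always_eventually intro: order_trans\<close>)
qed

lemma not_tendsto_zero_norm:
  assumes "\<not> (\<lambda>n. norm (f n)) \<longlonglongrightarrow> 0"
  obtains e where "0 < e" "\<And>N. \<exists>n\<ge>N. e \<le> norm (f n)"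
  using assms unfolding LIMSEQ_iff by (auto simp: not_less)

text \<open>A sequential form of a theorem of Dodds and Fremlin.\<close>

lemma disjoint_witnesses:
  fixes g :: "nat \<Rightarrow> 'a::banach_lattice dual"
  assumes null: "weak_star_null (\<lambda>n. \<bar>g n\<bar>)" and "\<not> (\<lambda>n. norm (g n)) \<longlonglongrightarrow> 0"
  obtains r :: "nat \<Rightarrow> nat" and z d where "strict_mono r" "0 < d" "\<And>n. 0 \<le> z n" "\<And>n. norm (z n) \<le> 1"
    "\<And>n m. n \<noteq> m \<Longrightarrow> inf (z n) (z m) = 0" "\<And>n. d \<le> \<bar>dual_apply (g (r n)) (z n)\<bar>"
proof -
  obtain e where e: "0 < e" "\<And>N. \<exists>n\<ge>N. e \<le> norm (g n)"
    using not_tendsto_zero_norm[OF assms(2)] by blast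
  define c where "c = e / 3"
  have c: "0 < c" "2 * c < e" using e by (simp_all add: c_def)
  have "\<exists>y\<ge>0. norm y \<le> 1 \<and> (e \<le> norm (g k) \<longrightarrow> c < \<bar>dual_apply (g k) y\<bar>)" for k
  proof (cases "e \<le> norm (g k)")
    case True
    then have "2 * c < norm (g k)" using c by simp
    then obtain y where "0 \<le> y" "norm y \<le> 1" "c < \<bar>dual_apply (g k) y\<bar>"
      by (rule norm_dual_witness) (use c in auto)
    then show ?thesis by blast
  next
    case False
    then show ?thesis by (intro exI[where x = 0]) simp
  qed
  then obtain Y where Y: "\<And>k. 0 \<le> Y k" "\<And>k. norm (Y k) \<le> 1"
    "\<And>k. e \<le> norm (g k) \<Longrightarrow> c < \<bar>dual_apply (g k) (Y k)\<bar>"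
    by metis
  \<comment> \<open>The sum runs over all indices up to \<open>s n\<close>, not only the selected
    ones, so that the condition on \<open>s (Suc n)\<close> depends only on \<open>n\<close> and
    \<open>s n\<close>, as the recursion demands.\<close>
  have "\<exists>s. \<forall>n. e \<le> norm (g (s n)) \<and>
      (s n < s (Suc n) \<and> dual_apply \<bar>g (s (Suc n))\<bar> (4 ^ n *\<^sub>R (\<Sum>i\<le>s n. Y i)) < c / 3)"
  proof (rule dependent_nat_choice)
    show "\<exists>k. e \<le> norm (g k)" using e(2)[of 0] by auto
    fix k n
    have "(\<lambda>m. dual_apply \<bar>g m\<bar> (4 ^ n *\<^sub>R (\<Sum>i\<le>k. Y i))) \<longlonglongrightarrow> 0"
      using null by (simp add: weak_star_null_def)
    then have "\<forall>\<^sub>F m in sequentially. dual_apply \<bar>g m\<bar> (4 ^ n *\<^sub>R (\<Sum>i\<le>k. Y i)) < c / 3"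
      using c by (intro order_tendstoD) auto
    then obtain M where M: "\<And>m. M \<le> m \<Longrightarrow> dual_apply \<bar>g m\<bar> (4 ^ n *\<^sub>R (\<Sum>i\<le>k. Y i)) < c / 3"
      by (auto simp: eventually_sequentially)
    obtain m where "max M (Suc k) \<le> m" "e \<le> norm (g m)" using e(2) by blast
    then show "\<exists>m. e \<le> norm (g m) \<and>
        (k < m \<and> dual_apply \<bar>g m\<bar> (4 ^ n *\<^sub>R (\<Sum>i\<le>k. Y i)) < c / 3)"
      using M by (intro exI[of _ m]) auto
  qed
  then obtain s where s: "\<And>n. e \<le> norm (g (s n))" "\<And>n. s n < s (Suc n)"
    "\<And>n. dual_apply \<bar>g (s (Suc n))\<bar> (4 ^ n *\<^sub>R (\<Sum>i\<le>s n. Y i)) < c / 3"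
    by blast
  have mono: "strict_mono s" using s(2) by (simp add: strict_mono_Suc_iff)
  obtain z w where zw: "0 \<le> w" "\<And>n. 0 \<le> z n" "\<And>n. z n \<le> Y (s (Suc n))"
    "\<And>n. Y (s (Suc n)) - z n \<le> 4 ^ n *\<^sub>R (\<Sum>i\<le>n. Y (s i)) + (1/2) ^ n *\<^sub>R w"
    "\<And>n m. n \<noteq> m \<Longrightarrow> inf (z n) (z m) = 0"
    using ex_disjoint_minorants[of "\<lambda>n. Y (s n)"] Y by metis
  have "strict_mono (\<lambda>n. s (Suc n))" using s(2) by (simp add: strict_mono_Suc_iff)
  then have "(\<lambda>n. dual_apply \<bar>g (s (Suc n))\<bar> w) \<longlonglongrightarrow> 0"
    using weak_star_null_subseq[OF null] unfolding weak_star_null_def by blast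
  then have "\<forall>\<^sub>F n in sequentially. dual_apply \<bar>g (s (Suc n))\<bar> w < c / 3"
    using c by (intro order_tendstoD) auto
  then obtain n0 where n0: "\<And>n. n0 \<le> n \<Longrightarrow> dual_apply \<bar>g (s (Suc n))\<bar> w < c / 3"
    by (auto simp: eventually_sequentially)
  \<comment> \<open>Passing from \<open>Y (s (Suc n))\<close> to \<open>z n\<close> costs at most
    \<open>c / 3\<close> for the earlier terms and \<open>c / 3\<close> for \<open>w\<close>, which
    leaves \<open>c / 3\<close>.\<close>
  have main: "c / 3 \<le> \<bar>dual_apply (g (s (Suc n))) (z n)\<bar>" if "n0 \<le> n" for n
  proof -
    let ?f = "g (s (Suc n))"
    have "(\<Sum>i\<le>n. Y (s i)) = sum Y (s ` {..n})"
      using sum.reindex[of s "{..n}" Y] strict_mono_imp_inj_on[OF mono] by (simp add: o_def inj_on_subset)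
    also have "\<dots> \<le> (\<Sum>i\<le>s n. Y i)"
      using Y(1) mono by (intro sum_mono2) (auto simp: strict_mono_less_eq)
    finally have "(4::real) ^ n *\<^sub>R (\<Sum>i\<le>n. Y (s i)) \<le> 4 ^ n *\<^sub>R (\<Sum>i\<le>s n. Y i)"
      by (intro scaleR_left_mono) auto
    moreover have "(1/2 :: real) ^ n *\<^sub>R w \<le> 1 *\<^sub>R w"
      using zw(1) by (intro scaleR_right_mono power_le_one) auto
    ultimately have "Y (s (Suc n)) - z n \<le> 4 ^ n *\<^sub>R (\<Sum>i\<le>s n. Y i) + w"
      using order_trans[OF zw(4)[of n] add_mono] by simp
    then have "dual_apply \<bar>?f\<bar> (Y (s (Suc n)) - z n) < c / 3 + c / 3"
      using dual_apply_mono[OF abs_ge_zero, of _ _ ?f] s(3)[of n] n0[OF that]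
      by (fastforce simp: dual_apply_linear simp del: dual_apply_simps)
    moreover have "\<bar>dual_apply ?f (Y (s (Suc n)) - z n)\<bar> \<le> dual_apply \<bar>?f\<bar> (Y (s (Suc n)) - z n)"
      using abs_dual_apply_le[of ?f "Y (s (Suc n)) - z n"] zw(3)[of n] by simp
    moreover have "c < \<bar>dual_apply ?f (Y (s (Suc n)))\<bar>" using Y(3) s(1) by blast
    ultimately show ?thesis by (simp add: dual_apply_linear)
  qed
  show ?thesis
  proof
    show "strict_mono (\<lambda>n. s (Suc (n + n0)))" using s(2) by (simp add: strict_mono_Suc_iff)
    show "0 < c / 3" using c by simp
    show "norm (z (n + n0)) \<le> 1" for n
      using norm_mono_nonneg[OF zw(2,3)[of "n + n0"]] Y(2) order_trans by blast
    show "inf (z (n + n0)) (z (m + n0)) = 0" if "n \<noteq> m" for n m using that zw(5) by simp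
  qed (use zw main in auto)
qed

text \<open>Disjoint vectors \<open>z n\<close> come from \<open>disjoint_witnesses\<close>; the
  band parts of the functionals at these vectors are disjoint, keep the values there and stay below
  the given weak* null sequence.\<close>

lemma not_positive_dual_schur_witness:
  assumes "\<not> positive_dual_schur TYPE('a::banach_lattice)"
  obtains g :: "nat \<Rightarrow> 'a::banach_lattice dual" and z d where "disjoint_seq g" "weak_star_null g" "\<And>n. 0 \<le> g n"
    "0 < d" "\<And>n. 0 \<le> z n" "\<And>n. norm (z n) \<le> 1" "\<And>n. d \<le> dual_apply (g n) (z n)"
proof -
  obtain f :: "nat \<Rightarrow> 'a dual" where f: "\<And>n. 0 \<le> f n" "weak_star_null f" "\<not> (\<lambda>n. norm (f n)) \<longlonglongrightarrow> 0"
    using assms by (auto simp: positive_dual_schur_def)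
  have "weak_star_null (\<lambda>n. \<bar>f n\<bar>)" using f by simp
  then show ?thesis
  proof (rule disjoint_witnesses[OF _ f(3)])
    fix r :: "nat \<Rightarrow> nat" and z :: "nat \<Rightarrow> 'a" and d
    assume rz: "strict_mono r" "0 < d" "\<And>n. 0 \<le> z n" "\<And>n. norm (z n) \<le> 1"
      "\<And>n m. n \<noteq> m \<Longrightarrow> inf (z n) (z m) = 0" "\<And>n. d \<le> \<bar>dual_apply (f (r n)) (z n)\<bar>"
    define g where "g n = band_part (f (r n)) (z n)" for n
    have g: "0 \<le> g n" "g n \<le> f (r n)" for n
      unfolding g_def by (intro band_part_nonneg band_part_le f rz)+
    show ?thesis
    proof (rule that)
      show "disjoint_seq g"
        unfolding disjoint_seq_def using g(1) rz(3,5) f(1) by (auto simp: g_def intro!: band_part_disjoint)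
      show "weak_star_null g"
        by (rule weak_star_null_dominated[OF weak_star_null_subseq[OF f(2) rz(1)]])
          (use g in \<open>auto intro: dual_leD\<close>)
      show "d \<le> dual_apply (g n) (z n)" for n
        using rz(6)[of n] dual_apply_nonneg[OF f(1) rz(3)]
        by (simp add: g_def band_part_self[OF f(1) rz(3)])
    qed (use rz g in auto)
  qed
qed

text \<open>The band parts \<open>g n\<close> of \<open>p\<close> at \<open>x n\<close> have partial
  sums below \<open>p\<close>. Order continuity forces the remainders to be small in norm, and
  \<open>g n (x n) = p (x n)\<close> is controlled by them.\<close>

lemma order_continuous_dual_imp_disjoint_weakly_null:
  fixes x :: "nat \<Rightarrow> 'a::banach_lattice"
  assumes oc: "order_continuous_norm TYPE('a dual)"
    and x: "\<And>n. 0 \<le> x n" "\<And>n. norm (x n) \<le> 1" "\<And>n m. n \<noteq> m \<Longrightarrow> inf (x n) (x m) = 0"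
  shows "(\<lambda>n. dual_apply f (x n)) \<longlonglongrightarrow> 0"
proof -
  define p where "p = \<bar>f\<bar>"
  have p: "0 \<le> p" by (simp add: p_def)
  define g where "g n = band_part p (x n)" for n
  have g: "0 \<le> g n" for n unfolding g_def by (rule band_part_nonneg[OF p x(1)])
  define s where "s N = (\<Sum>n<N. g n)" for N
  have s_le: "s N \<le> p" for N
    unfolding s_def g_def by (rule sum_band_part_le[OF p]) (use x in auto)
  have s_mono: "s N \<le> s M" if "N \<le> M" for N M
    unfolding s_def using that g by (intro sum_mono2) auto
  have dir: "\<exists>h\<in>range (\<lambda>N. p - s N). h \<le> f \<and> h \<le> g"
    if "f \<in> range (\<lambda>N. p - s N)" "g \<in> range (\<lambda>N. p - s N)" for f g
  proof -
    obtain N M where "f = p - s N" "g = p - s M" using \<open>f \<in> _\<close> \<open>g \<in> _\<close> by auto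
    then show ?thesis
      using s_mono[of N "max N M"] s_mono[of M "max N M"] by (intro bexI[of _ "p - s (max N M)"]) auto
  qed
  have nn: "0 \<le> f" if "f \<in> range (\<lambda>N. p - s N)" for f using s_le that by auto
  have "range (\<lambda>N. p - s N) \<noteq> {}" by simp
  from directed_inf_dual[OF this dir nn] obtain h where h: "0 \<le> h" "\<And>f. f \<in> range (\<lambda>N. p - s N) \<Longrightarrow> h \<le> f"
    "\<And>x c. 0 \<le> x \<Longrightarrow> (\<And>f. f \<in> range (\<lambda>N. p - s N) \<Longrightarrow> c \<le> dual_apply f x) \<Longrightarrow> c \<le> dual_apply h x"
    by blast
  have h_le: "h \<le> p - s N" for N using h(2) by blast
  \<comment> \<open>Subtracting the limit functional \<open>h\<close> gives a decreasing family with
    infimum 0, to which order continuity applies.\<close>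
  define D where "D = range (\<lambda>N. p - s N - h)"
  have "(INF d\<in>D. norm d) = 0"
  proof (rule oc[unfolded order_continuous_norm_def, rule_format], intro conjI ballI allI impI)
    show "D \<noteq> {}" by (simp add: D_def)
    fix d assume "d \<in> D"
    then obtain N where N: "d = p - s N - h" by (auto simp: D_def)
    show "0 \<le> d" using h_le by (simp add: N)
    fix d' assume "d' \<in> D"
    then obtain M where M: "d' = p - s M - h" by (auto simp: D_def)
    show "\<exists>z\<in>D. z \<le> d \<and> z \<le> d'"
      using s_mono[of N "max N M"] s_mono[of M "max N M"]
      by (intro bexI[of _ "p - s (max N M) - h"]) (auto simp: N M D_def)
  next
    fix z assume z: "\<forall>d\<in>D. z \<le> d"
    show "z \<le> 0"
      unfolding less_eq_dual_def
    proof (intro allI impI)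
      fix y :: 'a assume y: "0 \<le> y"
      have "dual_apply (z + h) y \<le> dual_apply h y"
      proof (rule h(3)[OF y])
        fix f' assume "f' \<in> range (\<lambda>N. p - s N)"
        then have "z \<le> f' - h" using z by (auto simp: D_def)
        then show "dual_apply (z + h) y \<le> dual_apply f' y"
          using dual_leD[of z "f' - h" y] y by simp
      qed
      then show "dual_apply z y \<le> dual_apply 0 y" by simp
    qed
  qed
  then have small: "\<exists>N. norm (p - s N - h) < e" if "0 < e" for e
    using cINF_greatest[of D e norm] that by (force simp: D_def not_less)
  have lim: "(\<lambda>n. dual_apply p (x n)) \<longlonglongrightarrow> 0"
  proof (rule LIMSEQ_I)
    fix e :: real assume "0 < e"
    then obtain N where N: "norm (p - s N - h) < e" using small by blast
    have "norm (dual_apply p (x n) - 0) < e" if "N \<le> n" for n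
    proof -
      \<comment> \<open>For \<open>n \<ge> N\<close>, \<open>g n\<close> is part of the sum beyond
        \<open>N\<close>, so it is bounded by the remainder \<open>p - s N - h\<close>.\<close>
      have "s N + g n \<le> s (Suc n)" using s_mono[OF that] by (simp add: s_def)
      also have "\<dots> \<le> p - h" using h_le[of "Suc n"] by (simp add: algebra_simps)
      finally have "g n \<le> p - s N - h" by (simp add: algebra_simps)
      then have "dual_apply (g n) (x n) \<le> dual_apply (p - s N - h) (x n)" by (rule dual_leD) (rule x)
      also have "\<dots> \<le> norm (p - s N - h) * norm (x n)"
        using dual_norm_le[of "p - s N - h" "x n"] by linarith
      also have "\<dots> \<le> norm (p - s N - h) * 1" by (intro mult_left_mono x) simp
      finally show ?thesis
        using N dual_apply_nonneg[OF p x(1)[of n]] by (simp add: g_def band_part_self[OF p x(1)])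
    qed
    then show "\<exists>N. \<forall>n\<ge>N. norm (dual_apply p (x n) - 0) < e" by blast
  qed
  have le: "norm (dual_apply f (x n)) \<le> dual_apply p (x n)" for n
    using abs_dual_apply_le[of f "x n"] x(1)[of n] by (simp add: p_def)
  show ?thesis by (rule Lim_null_comparison[OF _ lim]) (simp add: le[unfolded real_norm_def])
qed

text \<open>A directed set with infimum 0 but norms bounded below by \<open>c\<close> allows
  repeated descent by norm at least \<open>c / 2\<close>. The \<open>\<psi> n\<close> are the
  successive differences; their partial sums telescope below the first member.\<close>

lemma not_order_continuous_dual_witness:
  assumes "\<not> order_continuous_norm TYPE('a::banach_lattice dual)"
  obtains \<psi> :: "nat \<Rightarrow> 'a::banach_lattice dual" and \<phi> d where "\<And>n. 0 \<le> \<psi> n" "\<And>N. (\<Sum>n<N. \<psi> n) \<le> \<phi>"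
    "0 < d" "\<And>n. d \<le> norm (\<psi> n)"
proof -
  obtain D :: "'a dual set" where D: "D \<noteq> {}"
    "\<And>x y. x \<in> D \<Longrightarrow> y \<in> D \<Longrightarrow> \<exists>z\<in>D. z \<le> x \<and> z \<le> y" "\<And>x. x \<in> D \<Longrightarrow> 0 \<le> x"
    "\<forall>z. (\<forall>x\<in>D. z \<le> x) \<longrightarrow> z \<le> 0" "(INF x\<in>D. norm x) \<noteq> 0"
    using assms unfolding order_continuous_norm_def not_all not_imp by (elim exE conjE) (rule that; simp)
  define c where "c = (INF x\<in>D. norm x)"
  have "0 \<le> c" unfolding c_def using D(1) by (intro cINF_greatest) auto
  then have c: "0 < c" using D(5) by (simp add: c_def)
  have c_le: "c \<le> norm x" if "x \<in> D" for x
    unfolding c_def by (rule cINF_lower[OF bdd_belowI2[where m = 0]]) (use that in auto)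
  obtain h where h: "0 \<le> h" "\<And>f. f \<in> D \<Longrightarrow> h \<le> f"
    "\<And>x c. 0 \<le> x \<Longrightarrow> (\<And>f. f \<in> D \<Longrightarrow> c \<le> dual_apply f x) \<Longrightarrow> c \<le> dual_apply h x"
    using directed_inf_dual[OF D(1-3)] by metis
  have h0: "h \<le> 0" using D(4) h(2) by blast
  have step: "\<exists>f'. f' \<in> D \<and> (f' \<le> f \<and> c / 2 \<le> norm (f - f'))" if f: "f \<in> D" for f
  proof (rule ccontr)
    assume "\<not> ?thesis"
    then have near: "norm (f - f') \<le> c / 2" if "f' \<in> D" "f' \<le> f" for f'
      using that by force
    \<comment> \<open>If every smaller member were within \<open>c / 2\<close> of \<open>f\<close>,
      then passing to the pointwise infimum, which is at most 0, would give this bound.\<close>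
    have "norm f \<le> c / 2"
    proof (rule dual_norm_bound)
      fix x :: 'a
      have "dual_apply f \<bar>x\<bar> - c / 2 * norm x \<le> dual_apply h \<bar>x\<bar>"
      proof (rule h(3))
        fix f2 assume "f2 \<in> D"
        then obtain f' where f': "f' \<in> D" "f' \<le> f" "f' \<le> f2" using D(2) f by blast
        have "dual_apply (f - f') \<bar>x\<bar> \<le> norm (f - f') * norm x"
          using dual_norm_le[of "f - f'" "\<bar>x\<bar>"] by (simp add: norm_abs_banach_lattice)
        also have "\<dots> \<le> c / 2 * norm x" using near[OF f'(1,2)] by (intro mult_right_mono) auto
        finally show "dual_apply f \<bar>x\<bar> - c / 2 * norm x \<le> dual_apply f2 \<bar>x\<bar>"
          using dual_leD[OF f'(3), of "\<bar>x\<bar>"] by simp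
      qed simp
      also have "\<dots> \<le> 0" using dual_leD[OF h0, of "\<bar>x\<bar>"] by simp
      finally show "\<bar>dual_apply f x\<bar> \<le> c / 2 * norm x"
        using abs_dual_apply_le[of f x] D(3)[OF f] by simp
    qed (use c in simp)
    then show False using c_le[OF f] c by simp
  qed
  have "\<exists>u. \<forall>n::nat. u n \<in> D \<and> (u (Suc n) \<le> u n \<and> c / 2 \<le> norm (u n - u (Suc n)))"
    by (rule dependent_nat_choice) (use D(1) step in auto)
  then obtain u where u: "\<And>n::nat. u n \<in> D" "\<And>n. u (Suc n) \<le> u n" "\<And>n. c / 2 \<le> norm (u n - u (Suc n))"
    by blast
  show ?thesis
  proof
    show "(\<Sum>n<N. u n - u (Suc n)) \<le> u 0" for N
      using D(3)[OF u(1)] by (simp add: sum_lessThan_telescope')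
    show "0 < c / 2" using c by simp
    show "c / 2 \<le> norm (u n - u (Suc n))" for n by (rule u)
  qed (use u in auto)
qed

section \<open>Weak compactness\<close>

lemma openin_weak_vimage: "open V \<Longrightarrow> openin weak_topology (dual_apply f -` V)"
  unfolding weak_topology_def by (rule topology_generated_by_Basis) blast

lemma topspace_weak_topology [simp]: "topspace weak_topology = UNIV"
  using openin_subset[OF openin_weak_vimage[of UNIV]] by auto

lemma openin_weak_nhd: "openin weak_topology {y. \<bar>dual_apply f y - c\<bar> < e}"
proof -
  have "{y. \<bar>dual_apply f y - c\<bar> < e} = dual_apply f -` ball c e"
    by (auto simp: dist_real_def)
  then show ?thesis using openin_weak_vimage[of "ball c e"] by simp
qed

lemma weak_open_contains_nhd:
  assumes "openin weak_topology U" "x \<in> U"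
  shows "\<exists>G e. finite G \<and> 0 < e \<and> (\<forall>y. (\<forall>f\<in>G. \<bar>dual_apply f y - dual_apply f x\<bar> < e) \<longrightarrow> y \<in> U)"
proof -
  have "generate_topology_on {dual_apply f -` V | f V. open V} U"
    using assms(1) by (simp add: weak_topology_def openin_topology_generated_by_iff)
  then show ?thesis using assms(2)
  proof (induction U rule: generate_topology_on.induct)
    case (Int U V)
    then obtain G e H d where "finite G" "0 < e" "finite H" "0 < d"
      "\<forall>y. (\<forall>f\<in>G. \<bar>dual_apply f y - dual_apply f x\<bar> < e) \<longrightarrow> y \<in> U"
      "\<forall>y. (\<forall>f\<in>H. \<bar>dual_apply f y - dual_apply f x\<bar> < d) \<longrightarrow> y \<in> V"
      by blast
    then show ?case by (intro exI[of _ "G \<union> H"] exI[of _ "min e d"]) auto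
  next
    case (UN K)
    then obtain U where U: "U \<in> K" "x \<in> U" by blast
    then obtain G e where "finite G" "0 < e"
      "\<forall>y. (\<forall>f\<in>G. \<bar>dual_apply f y - dual_apply f x\<bar> < e) \<longrightarrow> y \<in> U"
      using UN.IH by blast
    then show ?case using U by blast
  next
    case (Basis U)
    then obtain f V where V: "U = dual_apply f -` V" "open V" by blast
    then obtain e where "0 < e" "ball (dual_apply f x) e \<subseteq> V"
      using Basis openE by blast
    then show ?case unfolding V
      by (intro exI[of _ "{f}"] exI[of _ e]) (auto simp: dist_real_def subset_iff abs_minus_commute)
  qed simp
qed

text \<open>Without the Hahn--Banach theorem, the weak topology is not known to be Hausdorff; hence
  points of the closure are identified only up to functionals.\<close>

lemma relatively_weakly_compact_range_null:
  fixes x :: "nat \<Rightarrow> 'a::real_normed_vector"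
  assumes null: "\<And>f. (\<lambda>n. dual_apply f (x n)) \<longlonglongrightarrow> 0"
  shows "relatively_weakly_compact (range x)"
proof -
  let ?K = "weak_topology closure_of (range x)"
  have ev: "\<exists>N. \<forall>n\<ge>N. x n \<in> U" if U: "openin weak_topology U" "0 \<in> U" for U
  proof -
    obtain G e where G: "finite G" "0 < e"
      "\<And>y. (\<forall>f\<in>G. \<bar>dual_apply f y - dual_apply f 0\<bar> < e) \<Longrightarrow> y \<in> U"
      using weak_open_contains_nhd[OF U] by blast
    have "\<forall>\<^sub>F n in sequentially. \<forall>f\<in>G. \<bar>dual_apply f (x n) - dual_apply f 0\<bar> < e"
      unfolding eventually_ball_finite_distrib[OF G(1)]
      using null G(2) by (auto simp: dual_apply_linear tendsto_iff dist_real_def)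
    then show ?thesis using G(3) by (force simp: eventually_sequentially)
  qed
  \<comment> \<open>Closure points act on functionals like 0 or like some \<open>x n\<close>.
    Otherwise \<open>V\<close> shuts out the tail of the sequence, and the finitely many
    \<open>W n\<close> shut out the remaining terms.\<close>
  have cl: "(\<forall>f. dual_apply f z = 0) \<or> (\<exists>n. \<forall>f. dual_apply f z = dual_apply f (x n))"
    if "z \<in> ?K" for z
  proof (rule ccontr)
    assume "\<not> ?thesis"
    then obtain f h where f: "dual_apply f z \<noteq> 0" and h: "\<And>n. dual_apply (h n) z \<noteq> dual_apply (h n) (x n)"
      by metis
    have "\<forall>\<^sub>F n in sequentially. \<bar>dual_apply f (x n)\<bar> < \<bar>dual_apply f z\<bar> / 2"
      using order_tendstoD(2)[OF tendsto_rabs_zero[OF null[of f]], of "\<bar>dual_apply f z\<bar> / 2"] f by simp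
    then obtain N where N: "\<And>n. N \<le> n \<Longrightarrow> \<bar>dual_apply f (x n)\<bar> < \<bar>dual_apply f z\<bar> / 2"
      by (auto simp: eventually_sequentially)
    define W where "W n = {y. \<bar>dual_apply (h n) y - dual_apply (h n) z\<bar> < \<bar>dual_apply (h n) (x n) - dual_apply (h n) z\<bar>}" for n
    define V where "V = {y. \<bar>dual_apply f y - dual_apply f z\<bar> < \<bar>dual_apply f z\<bar> / 2}"
    have "openin weak_topology V" "openin weak_topology (W n)" for n
      unfolding V_def W_def by (rule openin_weak_nhd)+
    then have V_open: "openin weak_topology (V \<inter> \<Inter> (W ` {..<N}))"
      by (cases "N = 0") (auto intro!: openin_Int openin_Inter)
    have "z \<in> V \<inter> \<Inter> (W ` {..<N})"
      using f h[THEN not_sym] by (simp add: V_def W_def)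
    from that[unfolded in_closure_of, THEN conjunct2, rule_format, OF conjI, OF this V_open]
    have "\<exists>y\<in>range x. y \<in> V \<inter> \<Inter> (W ` {..<N})" by (simp only: Bex_def)
    then obtain n where n: "x n \<in> V" "\<And>m. m < N \<Longrightarrow> x n \<in> W m" by auto
    show False
    proof (cases "n < N")
      case True
      then show ?thesis using n(2)[of n] by (simp add: W_def)
    next
      case False
      then show ?thesis using n(1) N[of n] by (simp add: V_def abs_if split: if_splits)
    qed
  qed
  have zero: "0 \<in> ?K"
    unfolding in_closure_of using ev by fastforce
  have x: "x n \<in> ?K" for n using closure_of_subset[of "range x" weak_topology] by auto
  show ?thesis
    unfolding relatively_weakly_compact_def compactin_def
  proof (intro conjI allI impI)
    fix \<U> assume U: "(\<forall>U\<in>\<U>. openin weak_topology U) \<and> ?K \<subseteq> \<Union> \<U>"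
    then obtain U0 where U0: "U0 \<in> \<U>" "0 \<in> U0" using zero by blast
    then obtain N where N: "\<And>n. N \<le> n \<Longrightarrow> x n \<in> U0" using ev U by blast
    have "\<exists>V\<in>\<U>. x n \<in> V" for n using x U by blast
    then obtain V where V: "\<And>n. V n \<in> \<U>" "\<And>n. x n \<in> V n" by metis
    have indist: "z \<in> W" if "W \<in> \<U>" "y \<in> W" "\<And>f. dual_apply f z = dual_apply f y" for W y z
      using weak_open_contains_nhd[of W y] U that by fastforce
    \<comment> \<open>\<open>U0\<close> covers the tail and the points equivalent to 0; the sets
      \<open>V n\<close> with \<open>n < N\<close> cover the rest.\<close>
    have "?K \<subseteq> \<Union> (insert U0 (V ` {..<N}))"
    proof
      fix z assume "z \<in> ?K"
      then consider "\<forall>f. dual_apply f z = 0" | n where "\<forall>f. dual_apply f z = dual_apply f (x n)"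
        using cl by blast
      then show "z \<in> \<Union> (insert U0 (V ` {..<N}))"
      proof cases
        case 1
        then show ?thesis using indist[OF U0, of z] by (simp add: dual_apply_linear)
      next
        case 2
        then show ?thesis
          using indist[OF V, of z n] indist[OF U0(1) N, of n z] by (cases "n < N") auto
      qed
    qed
    then show "\<exists>\<F>. finite \<F> \<and> \<F> \<subseteq> \<U> \<and> ?K \<subseteq> \<Union> \<F>"
      using U0 V by (intro exI[of _ "insert U0 (V ` {..<N})"]) auto
  qed simp
qed

text \<open>Were there no cluster point, each \<open>b\<close> would have a basic neighbourhood that
  the sequence avoids from \<open>M b\<close> on; finitely many of them cover the closure of
  \<open>A\<close>. No subsequence is extracted, so later arguments test finitely many functionals
  at a time.\<close>

lemma relatively_weakly_compact_cluster_point: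
  fixes a :: "nat \<Rightarrow> 'a::real_normed_vector"
  assumes A: "relatively_weakly_compact A" "\<And>k. a k \<in> A"
  obtains b where "\<And>G e M. finite G \<Longrightarrow> 0 < e \<Longrightarrow>
    \<exists>k\<ge>M. \<forall>f\<in>G. \<bar>dual_apply f (a k) - dual_apply f b\<bar> < e"
proof (rule ccontr)
  note cluster = that
  assume "\<not> thesis"
  then have "\<exists>G e M. finite G \<and> 0 < e \<and> (\<forall>k\<ge>M. \<exists>f\<in>G. \<not> \<bar>dual_apply f (a k) - dual_apply f b\<bar> < e)" for b
    using cluster[of b] by meson
  then obtain G e M where G: "\<And>b. finite (G b)" "\<And>b. 0 < e b"
    "\<And>b k. M b \<le> k \<Longrightarrow> \<exists>f\<in>G b. \<not> \<bar>dual_apply f (a k) - dual_apply f b\<bar> < e b"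
    by metis
  define U where "U b = {y. \<forall>f\<in>G b. \<bar>dual_apply f y - dual_apply f b\<bar> < e b}" for b
  have openU: "openin weak_topology (U b)" for b
  proof -
    have eq: "U b = UNIV \<inter> (\<Inter>f\<in>G b. {y. \<bar>dual_apply f y - dual_apply f b\<bar> < e b})"
      by (auto simp: U_def)
    show ?thesis unfolding eq using openin_topspace[of "weak_topology :: 'a topology"]
      by (cases "G b = {}") (auto intro!: openin_Inter simp: openin_weak_nhd G)
  qed
  let ?K = "weak_topology closure_of A"
  have "(\<forall>V\<in>range U. openin weak_topology V) \<and> ?K \<subseteq> \<Union> (range U)"
  proof -
    have "b \<in> U b" for b using G(2) by (simp add: U_def)
    then show ?thesis using openU by blast
  qed
  then obtain F where F: "finite F" "F \<subseteq> range U" "?K \<subseteq> \<Union> F"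
    using A(1) unfolding relatively_weakly_compact_def compactin_def by metis
  then obtain B where B: "finite B" "F = U ` B" by (metis finite_subset_image)
  \<comment> \<open>In the natural numbers the sum bounds every \<open>M b\<close> with
    \<open>b \<in> B\<close> from above.\<close>
  define k where "k = (\<Sum>b\<in>B. M b)"
  have "a k \<in> ?K" using closure_of_subset[of A weak_topology] A(2) by auto
  then obtain b where b: "b \<in> B" "a k \<in> U b" using F B by auto
  have "M b \<le> k" unfolding k_def by (rule member_le_sum) (use b B in auto)
  then show False using G(3)[of b k] b by (auto simp: U_def)
qed

text \<open>A sequence in \<open>A\<close> with \<open>\<bar>f (a k)\<bar> > k\<close> can have no
  cluster point. The bound may depend on \<open>f\<close>.\<close>

lemma relatively_weakly_compact_bounded:
  assumes "relatively_weakly_compact A"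
  shows "\<exists>C\<ge>0. \<forall>a\<in>A. \<bar>dual_apply f a\<bar> \<le> C"
proof (rule ccontr)
  assume "\<not> ?thesis"
  then have "\<exists>a\<in>A. real k < \<bar>dual_apply f a\<bar>" for k :: nat by (meson not_le of_nat_0_le_iff)
  then obtain a where a: "\<And>k. a k \<in> A" "\<And>k. real k < \<bar>dual_apply f (a k)\<bar>" by metis
  obtain b where b: "\<And>G e M. finite G \<Longrightarrow> 0 < e \<Longrightarrow>
    \<exists>k\<ge>M. \<forall>f\<in>G. \<bar>dual_apply f (a k) - dual_apply f b\<bar> < e"
    using relatively_weakly_compact_cluster_point[of A a, OF assms a(1)] by metis
  obtain M :: nat where M: "\<bar>dual_apply f b\<bar> + 1 \<le> M" using real_arch_simple by blast
  obtain k where k: "M \<le> k" "\<bar>dual_apply f (a k) - dual_apply f b\<bar> < 1"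
    using b[of "{f}" 1 M] by auto
  have "real M \<le> k" using k by simp
  then show False using a(2)[of k] M k by linarith
qed

section \<open>Operators factoring through the space of summable sequences\<close>

context
  fixes \<psi> :: "nat \<Rightarrow> 'a::banach_lattice dual" and \<phi> :: "'a dual"
  assumes psi_nonneg: "\<And>n. 0 \<le> \<psi> n" and psi_le: "\<And>N. (\<Sum>n<N. \<psi> n) \<le> \<phi>"
begin

text \<open>Positivity of \<open>\<psi> n\<close> moves the modulus onto \<open>x\<close>; the bound
  makes the coordinate map into \<open>\<ell>\<^sub>1\<close> bounded.\<close>

lemma sum_abs_apply_le: "(\<Sum>n<N. \<bar>dual_apply (\<psi> n) x\<bar>) \<le> dual_apply \<phi> \<bar>x\<bar>"
proof -
  have "(\<Sum>n<N. \<bar>dual_apply (\<psi> n) x\<bar>) \<le> (\<Sum>n<N. dual_apply (\<psi> n) \<bar>x\<bar>)"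
    using abs_dual_apply_le[of "\<psi> _" x] psi_nonneg by (intro sum_mono) simp
  also have "\<dots> \<le> dual_apply \<phi> \<bar>x\<bar>"
    using dual_leD[OF psi_le, of "\<bar>x\<bar>" N] by (simp add: dual_sum_apply)
  finally show ?thesis .
qed

lemma summable_abs_apply: "summable (\<lambda>n. \<bar>dual_apply (\<psi> n) x\<bar>)"
  by (rule summableI_nonneg_bounded[OF _ sum_abs_apply_le]) simp

text \<open>The \<open>\<ell>\<^sub>1\<close> norm of the coordinate sequence of \<open>x\<close>
  from index \<open>N\<close> on.\<close>

definition tail :: "nat \<Rightarrow> 'a \<Rightarrow> real" where
  "tail N x = (\<Sum>n. \<bar>dual_apply (\<psi> (n + N)) x\<bar>)"

lemma summable_tail: "summable (\<lambda>n. \<bar>dual_apply (\<psi> (n + N)) x\<bar>)"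
  using summable_ignore_initial_segment[OF summable_abs_apply] .

lemma tail_split: "tail N x = tail (N + k) x + (\<Sum>i<k. \<bar>dual_apply (\<psi> (i + N)) x\<bar>)"
  unfolding tail_def using suminf_split_initial_segment[OF summable_tail, of N x k]
  by (simp add: ac_simps)

lemma tail_antimono: "N \<le> M \<Longrightarrow> tail M x \<le> tail N x"
  using tail_split[of N x "M - N"] sum_nonneg[of "{..<M - N}" "\<lambda>i. \<bar>dual_apply (\<psi> (i + N)) x\<bar>"]
  by simp

lemma tail_eventually_small: "0 < e \<Longrightarrow> \<exists>N. \<forall>M\<ge>N. tail M x < e"
  using suminf_exist_split[OF _ summable_abs_apply, of e x] unfolding tail_def by fastforce

lemma tail_triangle: "tail N x \<le> tail N y + tail N (x - y)"
  unfolding tail_def suminf_add[OF summable_tail summable_tail]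
  by (intro suminf_le summable_add summable_tail) (simp add: dual_apply_linear)

text \<open>The coordinate map into \<open>\<ell>\<^sub>1\<close> followed by the map sending the
  n-th unit vector to \<open>y n\<close>. It serves twice: with real signs for \<open>y\<close> it
  yields a test functional, with lattice vectors the counterexample. The tail estimate measures
  approximation by finite rank operators.\<close>

lemma ex_series_operator:
  fixes y :: "nat \<Rightarrow> 'b::banach"
  assumes y: "\<And>n. norm (y n) \<le> 1"
  obtains T :: "'a \<Rightarrow>\<^sub>L 'b" where "\<And>x. (\<lambda>n. dual_apply (\<psi> n) x *\<^sub>R y n) sums blinfun_apply T x"
    "\<And>N x. norm (blinfun_apply T x - (\<Sum>n<N. dual_apply (\<psi> n) x *\<^sub>R y n)) \<le> tail N x"
proof -
  define t where "t x = (\<Sum>n. dual_apply (\<psi> n) x *\<^sub>R y n)" for x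
  have term_le: "norm (dual_apply (\<psi> n) x *\<^sub>R y n) \<le> \<bar>dual_apply (\<psi> n) x\<bar>" for n x
    using mult_left_mono[OF y, of "\<bar>dual_apply (\<psi> n) x\<bar>" n] by simp
  have summ: "summable (\<lambda>n. norm (dual_apply (\<psi> (n + N)) x *\<^sub>R y (n + N)))" for x N
    by (rule summable_comparison_test'[OF summable_tail[of N x], of 0]) (use term_le in simp)
  have sums: "(\<lambda>n. dual_apply (\<psi> n) x *\<^sub>R y n) sums t x" for x
    unfolding t_def using summable_sums[OF summable_norm_cancel[OF summ[of 0 x]]] by simp
  have est: "norm (t x - (\<Sum>n<N. dual_apply (\<psi> n) x *\<^sub>R y n)) \<le> tail N x" for x N
  proof -
    have "t x - (\<Sum>n<N. dual_apply (\<psi> n) x *\<^sub>R y n) = (\<Sum>n. dual_apply (\<psi> (n + N)) x *\<^sub>R y (n + N))"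
      using sums_split_initial_segment[OF sums[of x], of N] by (rule sums_unique)
    also have "norm \<dots> \<le> (\<Sum>n. norm (dual_apply (\<psi> (n + N)) x *\<^sub>R y (n + N)))"
      by (rule summable_norm[OF summ])
    also have "\<dots> \<le> tail N x"
      unfolding tail_def by (rule suminf_le[OF term_le summ summable_tail])
    finally show ?thesis .
  qed
  have "bounded_linear t"
  proof (rule bounded_linear_intro)
    show "t (x + x') = t x + t x'" for x x'
      using sums_unique2[OF sums[of "x + x'"]] sums_add[OF sums[of x] sums[of x']]
      by (simp add: dual_apply_linear scaleR_add_left)
    show "t (r *\<^sub>R x) = r *\<^sub>R t x" for r x
      using sums_unique2[OF sums[of "r *\<^sub>R x"]] sums_scaleR_right[OF sums[of x], of r]
      by (simp add: dual_apply_linear)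
    show "norm (t x) \<le> norm x * norm \<phi>" for x
    proof -
      have "norm (t x) \<le> tail 0 x" using est[of x 0] by simp
      also have "\<dots> \<le> dual_apply \<phi> \<bar>x\<bar>"
        unfolding tail_def using suminf_le_const[OF summable_abs_apply sum_abs_apply_le] by simp
      also have "\<dots> \<le> norm \<phi> * norm x"
        using dual_norm_le[of \<phi> "\<bar>x\<bar>"] by (simp add: norm_abs_banach_lattice)
      finally show ?thesis by (simp add: mult.commute)
    qed
  qed
  then have "blinfun_apply (Blinfun t) x = t x" for x by (simp add: bounded_linear_Blinfun_apply)
  then show ?thesis using that[of "Blinfun t"] sums est by simp
qed

text \<open>Gliding hump: this is the Schur property of the space of summable sequences.\<close>

lemma relatively_weakly_compact_tail:
  assumes A: "relatively_weakly_compact A" and e: "0 < e"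
  shows "\<exists>N. \<forall>x\<in>A. tail N x \<le> e"
proof (rule ccontr)
  assume "\<not> ?thesis"
  then have "\<exists>x\<in>A. e < tail N x" for N by (meson not_le)
  then obtain a where a: "\<And>N. a N \<in> A" "\<And>N. e < tail N (a N)" by metis
  obtain b where b: "\<And>G d M. finite G \<Longrightarrow> 0 < d \<Longrightarrow>
      \<exists>k\<ge>M. \<forall>f\<in>G. \<bar>dual_apply f (a k) - dual_apply f b\<bar> < d"
    using relatively_weakly_compact_cluster_point[of A a, OF A a(1)] by metis
  \<comment> \<open>Along the differences \<open>c k\<close> every finite block of coordinates
    becomes small infinitely often, which starts the gliding hump.\<close>
  define c where "c k = a k - b" for k
  define init where "init N x = (\<Sum>n<N. \<bar>dual_apply (\<psi> n) x\<bar>)" for N x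
  have near: "\<exists>k\<ge>M. init N (c k) < d" if "0 < d" for N M d
  proof -
    have d': "0 < d / (N + 1)" using that by simp
    obtain k where k: "M \<le> k" "\<forall>f\<in>\<psi> ` {..<N}. \<bar>dual_apply f (a k) - dual_apply f b\<bar> < d / (N + 1)"
      using b[OF _ d', of "\<psi> ` {..<N}" M] by auto
    have "init N (c k) \<le> real (card {..<N}) * (d / (N + 1))"
      unfolding init_def by (rule sum_bounded_above) (use k in \<open>auto simp: c_def dual_apply_linear less_imp_le\<close>)
    also have "\<dots> < d" using that by (simp add: field_simps)
    finally show ?thesis using k by blast
  qed
  obtain N0 where N0: "\<And>N. N0 \<le> N \<Longrightarrow> tail N b < e / 4"
    using tail_eventually_small[of "e / 4" b] e by auto
  \<comment> \<open>\<open>e / 8\<close> serves the estimate of the hump;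
    \<open>1 / real (Suc j)\<close> makes each coordinate tend to 0 along the chosen
    sequence.\<close>
  define d where "d j = min (e / 8) (1 / real (Suc j))" for j
  have d: "0 < d j" for j using e by (simp add: d_def)
  \<comment> \<open>A pair \<open>s\<close> holds a block start \<open>fst s\<close> and a sequence
    index \<open>snd s\<close>. \<open>P\<close> makes the coordinates before the block small,
    \<open>Q\<close> those from the next block start on.\<close>
  define P where "P j s \<longleftrightarrow> N0 \<le> fst s \<and> j \<le> fst s \<and> fst s \<le> snd s \<and> init (fst s) (c (snd s)) < d j"
    for j and s :: "nat \<times> nat"
  define Q where "Q s s' \<longleftrightarrow> fst s < fst s' \<and> tail (fst s') (c (snd s)) < e / 8"
    for s s' :: "nat \<times> nat"
  have "\<exists>s. \<forall>j. P j (s j) \<and> Q (s j) (s (Suc j))"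
  proof (rule dependent_nat_choice)
    obtain k where "N0 \<le> k" "init N0 (c k) < d 0" using near[OF d] by blast
    then show "\<exists>s. P 0 s" by (intro exI[where x = "(N0, k)"]) (simp add: P_def)
    fix s j assume s: "P j s"
    obtain N where N: "\<And>M. N \<le> M \<Longrightarrow> tail M (c (snd s)) < e / 8"
      using tail_eventually_small[of "e / 8"] e by auto
    define N' where "N' = N + N0 + Suc j + Suc (fst s)"
    obtain k where "N' \<le> k" "init N' (c k) < d (Suc j)" using near[OF d] by blast
    then show "\<exists>s'. P (Suc j) s' \<and> Q s s'"
      using N by (intro exI[where x = "(N', k)"]) (simp add: P_def Q_def N'_def)
  qed
  then obtain s where s: "\<And>j. P j (s j)" "\<And>j. Q (s j) (s (Suc j))" by blast
  define nn kk where "nn j = fst (s j)" and "kk j = snd (s j)" for j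
  have nk: "N0 \<le> nn j" "j \<le> nn j" "nn j \<le> kk j" "init (nn j) (c (kk j)) < d j"
    "nn j < nn (Suc j)" "tail (nn (Suc j)) (c (kk j)) < e / 8" for j
    using s[of j] by (simp_all add: P_def Q_def nn_def kk_def)
  have mono: "strict_mono nn" using nk(5) by (simp add: strict_mono_Suc_iff)
  \<comment> \<open>The \<open>LEAST\<close> finds the block of \<open>n\<close>, so on each block
    \<open>\<beta>\<close> carries the signs of the corresponding vector.\<close>
  define \<beta> where "\<beta> n = sgn (dual_apply (\<psi> n) (c (kk (LEAST j. n < nn (Suc j)))))" for n
  have \<beta>: "dual_apply (\<psi> n) (c (kk j)) * \<beta> n = \<bar>dual_apply (\<psi> n) (c (kk j))\<bar>"
    if "nn j \<le> n" "n < nn (Suc j)" for n j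
  proof -
    have "(LEAST i. n < nn (Suc i)) = j"
    proof (rule Least_equality)
      fix i assume "n < nn (Suc i)"
      then have "nn j < nn (Suc i)" using that by simp
      then show "j \<le> i" using mono by (simp add: strict_mono_less)
    qed (rule that)
    then show ?thesis by (simp add: \<beta>_def abs_sgn)
  qed
  have \<beta>1: "\<bar>\<beta> n\<bar> \<le> 1" for n by (simp add: \<beta>_def sgn_if)
  obtain T :: "'a \<Rightarrow>\<^sub>L real" where T: "\<And>x. (\<lambda>n. dual_apply (\<psi> n) x *\<^sub>R \<beta> n) sums blinfun_apply T x"
    "\<And>N x. norm (blinfun_apply T x - (\<Sum>n<N. dual_apply (\<psi> n) x *\<^sub>R \<beta> n)) \<le> tail N x"
    using ex_series_operator[of \<beta>, unfolded real_norm_def, OF \<beta>1] by auto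
  obtain F where F: "\<And>x. dual_apply F x = blinfun_apply T x"
    using ex_dual_apply[OF blinfun.bounded_linear_right[of T]] by blast
  \<comment> \<open>The tail from \<open>nn j\<close> exceeds \<open>3 * e / 4\<close>; the block
    keeps more than \<open>5 * e / 8\<close> of it, and the coordinates before and after cost at
    most \<open>e / 8\<close> each.\<close>
  have F_large: "3 * e / 8 \<le> dual_apply F (c (kk j))" for j
  proof -
    let ?x = "c (kk j)" and ?t = "\<lambda>n. dual_apply (\<psi> n) (c (kk j)) * \<beta> n"
    have "e < tail (kk j) (a (kk j))" by (rule a)
    also have "\<dots> \<le> tail (nn j) (a (kk j))" by (rule tail_antimono[OF nk(3)])
    also have "\<dots> \<le> tail (nn j) b + tail (nn j) ?x" unfolding c_def by (rule tail_triangle)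
    finally have t1: "3 * e / 4 < tail (nn j) ?x" using N0[OF nk(1)[of j]] by simp
    have "tail (nn j) ?x = tail (nn (Suc j)) ?x + (\<Sum>i<nn (Suc j) - nn j. \<bar>dual_apply (\<psi> (i + nn j)) ?x\<bar>)"
      using tail_split[of "nn j" ?x "nn (Suc j) - nn j"] nk(5)[of j] by simp
    also have "(\<Sum>i<nn (Suc j) - nn j. \<bar>dual_apply (\<psi> (i + nn j)) ?x\<bar>) = (\<Sum>n=nn j..<nn (Suc j). \<bar>dual_apply (\<psi> n) ?x\<bar>)"
      using sum.shift_bounds_nat_ivl[of "\<lambda>n. \<bar>dual_apply (\<psi> n) ?x\<bar>" 0 "nn j" "nn (Suc j) - nn j"] nk(5)[of j]
      by (simp add: atLeast0LessThan)
    also have "\<dots> = (\<Sum>n=nn j..<nn (Suc j). ?t n)" by (rule sum.cong) (auto simp: \<beta>)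
    finally have t2: "5 * e / 8 < (\<Sum>n=nn j..<nn (Suc j). ?t n)" using t1 nk(6)[of j] by simp
    have "\<bar>\<Sum>n<nn j. ?t n\<bar> \<le> init (nn j) ?x"
      unfolding init_def using \<beta>1 by (intro order_trans[OF sum_abs] sum_mono) (auto simp: abs_mult intro: mult_left_le)
    moreover have "init (nn j) ?x < e / 8" using nk(4)[of j] by (simp add: d_def)
    ultimately have t3: "- (e / 8) \<le> (\<Sum>n<nn j. ?t n)" by linarith
    have "(\<Sum>n<nn (Suc j). ?t n) = (\<Sum>n<nn j. ?t n) + (\<Sum>n=nn j..<nn (Suc j). ?t n)"
      using sum.atLeastLessThan_concat[of 0 "nn j" "nn (Suc j)" ?t] nk(5)[of j] by (simp add: atLeast0LessThan)
    then show ?thesis using T(2)[of ?x "nn (Suc j)"] nk(6)[of j] t2 t3 by (simp add: F abs_le_iff)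
  qed
  \<comment> \<open>A second cluster point, now of the selected subsequence, is confronted with
    \<open>F\<close>. It has the same coordinates as \<open>b\<close>, hence
    \<open>F b' = F b\<close>, while \<open>F_large\<close> keeps \<open>F (a (kk j))\<close> away
    from \<open>F b\<close>.\<close>
  obtain b' where b': "\<And>G d M. finite G \<Longrightarrow> 0 < d \<Longrightarrow>
      \<exists>j\<ge>M. \<forall>f\<in>G. \<bar>dual_apply f (a (kk j)) - dual_apply f b'\<bar> < d"
    using relatively_weakly_compact_cluster_point[of A "\<lambda>j. a (kk j)", OF A a(1)] by metis
  have coord: "dual_apply (\<psi> n) b' = dual_apply (\<psi> n) b" for n
  proof (rule ccontr)
    assume neq: "\<not> ?thesis"
    \<comment> \<open>Half the gap, as \<open>\<psi> n (a (kk j))\<close> will be within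
      \<open>h\<close> of both values.\<close>
    define h where "h = \<bar>dual_apply (\<psi> n) b' - dual_apply (\<psi> n) b\<bar> / 2"
    have h: "0 < h" using neq by (simp add: h_def)
    obtain m where m: "1 / real (Suc m) < h" using h nat_approx_posE by blast
    obtain j where j: "m + Suc n \<le> j" "\<bar>dual_apply (\<psi> n) (a (kk j)) - dual_apply (\<psi> n) b'\<bar> < h"
      using b'[of "{\<psi> n}" h "m + Suc n"] h by auto
    have "n < nn j" using nk(2)[of j] j(1) by simp
    then have "\<bar>dual_apply (\<psi> n) (c (kk j))\<bar> \<le> init (nn j) (c (kk j))"
      unfolding init_def by (intro member_le_sum_nonneg[where u = "\<lambda>n. \<bar>dual_apply (\<psi> n) (c (kk j))\<bar>"]) auto
    also have "\<dots> < 1 / real (Suc j)" using nk(4)[of j] by (simp add: d_def)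
    also have "\<dots> \<le> 1 / real (Suc m)" using j(1) by (intro divide_left_mono) auto
    finally have "\<bar>dual_apply (\<psi> n) (a (kk j)) - dual_apply (\<psi> n) b\<bar> < h"
      using m by (simp add: c_def dual_apply_linear)
    from le_less_trans[OF abs_triangle_ineq4 add_strict_mono[OF this j(2)]]
    have "\<bar>(dual_apply (\<psi> n) (a (kk j)) - dual_apply (\<psi> n) b) -
        (dual_apply (\<psi> n) (a (kk j)) - dual_apply (\<psi> n) b')\<bar> < h + h"
      .
    then show False by (simp add: h_def)
  qed
  have "dual_apply F b' = dual_apply F b"
    using T(1)[of b] T(1)[of b'] sums_unique2 unfolding F coord by blast
  moreover obtain j where "\<bar>dual_apply F (a (kk j)) - dual_apply F b'\<bar> < e / 8"
    using b'[of "{F}" "e / 8" 0] e by auto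
  ultimately show False using F_large[of j] e by (simp add: c_def dual_apply_linear)
qed

end

section \<open>Almost limited operators\<close>

lemma almost_limited_setD:
  assumes "almost_limited_set A" "disjoint_seq f" "weak_star_null f" "0 < e"
  shows "\<exists>N. \<forall>n\<ge>N. \<forall>y\<in>A. \<bar>dual_apply (f n) y\<bar> < e"
proof -
  have "(\<lambda>n. SUP y\<in>A. ennreal \<bar>dual_apply (f n) y\<bar>) \<longlonglongrightarrow> 0"
    using assms by (simp add: almost_limited_set_def)
  then have "\<forall>\<^sub>F n in sequentially. (SUP y\<in>A. ennreal \<bar>dual_apply (f n) y\<bar>) < ennreal e"
    using assms(4) by (intro order_tendstoD) auto
  then obtain N where N: "\<And>n. N \<le> n \<Longrightarrow> (SUP y\<in>A. ennreal \<bar>dual_apply (f n) y\<bar>) < ennreal e"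
    by (auto simp: eventually_sequentially)
  have "\<bar>dual_apply (f n) y\<bar> < e" if "N \<le> n" "y \<in> A" for n y
  proof -
    have "ennreal \<bar>dual_apply (f n) y\<bar> \<le> (SUP y\<in>A. ennreal \<bar>dual_apply (f n) y\<bar>)"
      using that by (intro SUP_upper)
    also have "\<dots> < ennreal e" using N that by blast
    finally show ?thesis by (simp add: ennreal_less_iff)
  qed
  then show ?thesis by blast
qed

lemma almost_limited_setI:
  assumes "bounded A"
    and "\<And>f e. disjoint_seq f \<Longrightarrow> weak_star_null f \<Longrightarrow> 0 < e \<Longrightarrow> \<exists>N. \<forall>n\<ge>N. \<forall>y\<in>A. \<bar>dual_apply (f n) y\<bar> \<le> e"
  shows "almost_limited_set A"
  unfolding almost_limited_set_def
proof (intro conjI allI impI assms(1))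
  fix f :: "nat \<Rightarrow> 'a dual" assume f: "disjoint_seq f \<and> weak_star_null f"
  show "(\<lambda>n. SUP y\<in>A. ennreal \<bar>dual_apply (f n) y\<bar>) \<longlonglongrightarrow> 0"
  proof (rule tendsto_zero_ennreal)
    fix r :: real assume r: "0 < r"
    then obtain N where N: "\<And>n y. N \<le> n \<Longrightarrow> y \<in> A \<Longrightarrow> \<bar>dual_apply (f n) y\<bar> \<le> r / 2"
      using assms(2)[of f "r / 2"] f by auto
    have "(SUP y\<in>A. ennreal \<bar>dual_apply (f n) y\<bar>) < ennreal r" if "N \<le> n" for n
    proof -
      have "(SUP y\<in>A. ennreal \<bar>dual_apply (f n) y\<bar>) \<le> ennreal (r / 2)"
        using N[OF that] by (intro SUP_least ennreal_leI)
      also have "\<dots> < ennreal r" using r by (intro ennreal_lessI) auto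
      finally show ?thesis .
    qed
    then show "\<forall>\<^sub>F n in sequentially. (SUP y\<in>A. ennreal \<bar>dual_apply (f n) y\<bar>) < ennreal r"
      by (auto simp: eventually_sequentially)
  qed
qed

text \<open>\<open>g n\<close> is the image of \<open>f n\<close> under the adjoint of
  \<open>T\<close>, described by its values. Its norm bounds \<open>f n\<close> on the image of the
  unit ball.\<close>

lemma almost_limitedI:
  fixes T :: "'a::banach \<Rightarrow>\<^sub>L 'b::banach_lattice"
  assumes "\<And>f g. disjoint_seq f \<Longrightarrow> weak_star_null f \<Longrightarrow>
    (\<And>n x. dual_apply (g n) x = dual_apply (f n) (blinfun_apply T x)) \<Longrightarrow> (\<lambda>n. norm (g n)) \<longlonglongrightarrow> 0"
  shows "almost_limited T"
  unfolding almost_limited_def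
proof (rule almost_limited_setI)
  show "bounded (blinfun_apply T ` cball 0 1)"
    by (intro bounded_linear_image blinfun.bounded_linear_right bounded_cball)
  fix f :: "nat \<Rightarrow> 'b dual" and e :: real
  assume f: "disjoint_seq f" "weak_star_null f" and e: "0 < e"
  have "\<exists>g. \<forall>x. dual_apply g x = dual_apply (f n) (blinfun_apply T x)" for n
    by (intro ex_dual_apply bounded_linear_compose[OF bounded_linear_dual_apply] blinfun.bounded_linear_right)
  then obtain g where g: "\<And>n x. dual_apply (g n) x = dual_apply (f n) (blinfun_apply T x)" by metis
  have "(\<lambda>n. norm (g n)) \<longlonglongrightarrow> 0" using assms f g by blast
  then have "\<forall>\<^sub>F n in sequentially. norm (g n) < e" using e by (intro order_tendstoD) auto
  then obtain N where N: "\<And>n. N \<le> n \<Longrightarrow> norm (g n) < e" by (auto simp: eventually_sequentially)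
  have "\<bar>dual_apply (f n) (blinfun_apply T x)\<bar> \<le> e" if "N \<le> n" "norm x \<le> 1" for n x
  proof -
    have "norm (g n) * norm x \<le> norm (g n) * 1" using that by (intro mult_left_mono) auto
    then show ?thesis using dual_norm_le[of "g n" x] N[OF that(1)] by (simp add: g)
  qed
  then show "\<exists>N. \<forall>n\<ge>N. \<forall>y\<in>blinfun_apply T ` cball 0 1. \<bar>dual_apply (f n) y\<bar> \<le> e"
    by (intro exI[of _ N]) auto
qed

section \<open>The two sufficient conditions\<close>

lemma positive_dual_schur_imp_almost_limited:
  fixes T :: "'a::banach \<Rightarrow>\<^sub>L 'b::banach_lattice"
  assumes d: "property_d TYPE('b)" and schur: "positive_dual_schur TYPE('b)"
  shows "almost_limited T"
proof (rule almost_limitedI)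
  fix f :: "nat \<Rightarrow> 'b dual" and g :: "nat \<Rightarrow> 'a dual"
  assume f: "disjoint_seq f" "weak_star_null f"
    and g: "\<And>n x. dual_apply (g n) x = dual_apply (f n) (blinfun_apply T x)"
  \<comment> \<open>Property (d) passes to the positive sequence of the moduli, to which the Schur
    hypothesis applies.\<close>
  have "weak_star_null (\<lambda>n. \<bar>f n\<bar>)" using d f by (simp add: property_d_def)
  then have "(\<lambda>n. norm \<bar>f n\<bar>) \<longlonglongrightarrow> 0"
    using schur unfolding positive_dual_schur_def by (metis abs_ge_zero)
  then have lim: "(\<lambda>n. norm (f n) * norm T) \<longlonglongrightarrow> 0"
    by (simp add: norm_abs_banach_lattice tendsto_mult_left_zero)
  have "norm (g n) \<le> norm (f n) * norm T" for n
  proof (rule dual_norm_bound)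
    fix x
    have "\<bar>dual_apply (f n) (blinfun_apply T x)\<bar> \<le> norm (f n) * norm (blinfun_apply T x)" by (rule dual_norm_le)
    also have "\<dots> \<le> norm (f n) * (norm T * norm x)" by (intro mult_left_mono norm_blinfun) simp
    finally show "\<bar>dual_apply (g n) x\<bar> \<le> norm (f n) * norm T * norm x" by (simp add: g mult.assoc)
  qed simp
  then show "(\<lambda>n. norm (g n)) \<longlonglongrightarrow> 0" by (intro Lim_null_comparison[OF _ lim]) simp
qed

text \<open>Weak almost limitedness is applied to one set only: the range of a disjoint sequence on
  which the adjoint images would stay large.\<close>

lemma order_continuous_dual_imp_almost_limited:
  fixes T :: "'a::banach_lattice \<Rightarrow>\<^sub>L 'b::banach_lattice"
  assumes d: "property_d TYPE('b)" and oc: "order_continuous_norm TYPE('a dual)"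
    and ob: "order_bounded_operator T" and wal: "weak_almost_limited T"
  shows "almost_limited T"
proof (rule almost_limitedI)
  fix f :: "nat \<Rightarrow> 'b dual" and g :: "nat \<Rightarrow> 'a dual"
  assume f: "disjoint_seq f" "weak_star_null f"
    and g: "\<And>n x. dual_apply (g n) x = dual_apply (f n) (blinfun_apply T x)"
  have f_abs: "weak_star_null (\<lambda>n. \<bar>f n\<bar>)" using d f by (simp add: property_d_def)
  have "weak_star_null (\<lambda>n. \<bar>g n\<bar>)"
    unfolding weak_star_null_def
  proof
    fix x :: 'a
    \<comment> \<open>Order boundedness transfers the domination: values of
      \<open>\<bar>g n\<bar>\<close> at \<open>x\<close> are controlled by those of
      \<open>\<bar>f n\<bar>\<close> at a fixed vector.\<close>
    obtain u v where uv: "blinfun_apply T ` {- \<bar>x\<bar>..\<bar>x\<bar>} \<subseteq> {u..v}"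
      using ob unfolding order_bounded_operator_def by blast
    have le: "\<bar>dual_apply \<bar>g n\<bar> x\<bar> \<le> dual_apply \<bar>f n\<bar> (\<bar>u\<bar> + \<bar>v\<bar>)" for n
    proof -
      have "\<bar>dual_apply \<bar>g n\<bar> x\<bar> \<le> dual_apply \<bar>g n\<bar> \<bar>x\<bar>"
        using abs_dual_apply_le[of "\<bar>g n\<bar>" x] by simp
      also have "\<dots> \<le> dual_apply \<bar>f n\<bar> (\<bar>u\<bar> + \<bar>v\<bar>)"
      proof (rule abs_dual_apply_least)
        fix y assume "\<bar>y\<bar> \<le> \<bar>x\<bar>"
        then have "y \<in> {- \<bar>x\<bar>..\<bar>x\<bar>}" by (auto simp: abs_le_iff minus_le_iff)
        then have Ty: "u \<le> blinfun_apply T y" "blinfun_apply T y \<le> v" using subsetD[OF uv imageI] by auto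
        have "v \<le> \<bar>u\<bar> + \<bar>v\<bar>" by (rule order_trans[OF abs_ge_self]) simp
        moreover have "- u \<le> \<bar>u\<bar> + \<bar>v\<bar>" by (rule order_trans[OF abs_ge_minus_self]) simp
        ultimately have "\<bar>blinfun_apply T y\<bar> \<le> \<bar>u\<bar> + \<bar>v\<bar>"
          by (intro abs_leI order_trans[OF Ty(2)] order_trans[OF le_imp_neg_le[OF Ty(1)]])
        then have "dual_apply \<bar>f n\<bar> \<bar>blinfun_apply T y\<bar> \<le> dual_apply \<bar>f n\<bar> (\<bar>u\<bar> + \<bar>v\<bar>)"
          by (intro dual_apply_mono) simp
        then show "dual_apply (g n) y \<le> dual_apply \<bar>f n\<bar> (\<bar>u\<bar> + \<bar>v\<bar>)"
          using abs_dual_apply_le[of "f n" "blinfun_apply T y"] by (simp add: g)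
      qed simp
      finally show ?thesis .
    qed
    have "(\<lambda>n. dual_apply \<bar>f n\<bar> (\<bar>u\<bar> + \<bar>v\<bar>)) \<longlonglongrightarrow> 0"
      using f_abs unfolding weak_star_null_def by blast
    then show "(\<lambda>n. dual_apply \<bar>g n\<bar> x) \<longlonglongrightarrow> 0"
      by (rule Lim_null_comparison[rotated]) (simp add: le del: dual_apply_simps)
  qed
  moreover have False if "weak_star_null (\<lambda>n. \<bar>g n\<bar>)" "\<not> (\<lambda>n. norm (g n)) \<longlonglongrightarrow> 0"
  proof (rule disjoint_witnesses[OF that])
    fix r :: "nat \<Rightarrow> nat" and z :: "nat \<Rightarrow> 'a" and c
    assume rz: "strict_mono r" "0 < c" "\<And>n. 0 \<le> z n" "\<And>n. norm (z n) \<le> 1"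
      "\<And>n m. n \<noteq> m \<Longrightarrow> inf (z n) (z m) = 0" "\<And>n. c \<le> \<bar>dual_apply (g (r n)) (z n)\<bar>"
    have "relatively_weakly_compact (range z)"
      by (intro relatively_weakly_compact_range_null order_continuous_dual_imp_disjoint_weakly_null[OF oc] rz)
    then have "almost_limited_set (blinfun_apply T ` range z)"
      using wal by (simp add: weak_almost_limited_def)
    from almost_limited_setD[OF this f rz(2)] obtain N
      where N: "\<And>n k. N \<le> n \<Longrightarrow> \<bar>dual_apply (f n) (blinfun_apply T (z k))\<bar> < c" by auto
    \<comment> \<open>The bound by \<open>c\<close> holds for all members of the range
      simultaneously, so it may be read at \<open>f (r N)\<close> and \<open>z N\<close>.\<close>
    have "N \<le> r N" using rz(1) by (rule strict_mono_imp_increasing)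
    then show False using N[of "r N" N] rz(6)[of N] by (simp add: g)
  qed
  ultimately show "(\<lambda>n. norm (g n)) \<longlonglongrightarrow> 0" by blast
qed

section \<open>The counterexample when both conditions fail\<close>

text \<open>Uniform boundedness; positivity replaces the Baire category argument.\<close>

lemma weak_star_null_abs_bounded:
  fixes f :: "nat \<Rightarrow> 'a::banach_lattice dual"
  assumes null: "weak_star_null (\<lambda>n. \<bar>f n\<bar>)"
  shows "\<exists>M>0. \<forall>n. norm (f n) \<le> M"
proof (rule ccontr)
  assume "\<not> ?thesis"
  \<comment> \<open>Growth \<open>4 ^ k\<close> outweighs the damping \<open>(1/2) ^ k\<close> of
    the majorant \<open>w\<close>, so that the values at \<open>w\<close> would reach every
    \<open>2 ^ k\<close>.\<close>
  then have "\<exists>n. 2 * 4 ^ k < norm (f n)" for k :: nat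
    by (metis not_le zero_less_mult_iff zero_less_numeral zero_less_power)
  then obtain r where r: "\<And>k. 2 * 4 ^ k < norm (f (r k))" by metis
  have "\<exists>y\<ge>0. norm y \<le> 1 \<and> 4 ^ k < \<bar>dual_apply (f (r k)) y\<bar>" for k
    using norm_dual_witness[OF r[of k]] by (metis zero_le_numeral zero_le_power)
  then obtain y where y: "\<And>k. 0 \<le> y k" "\<And>k. norm (y k) \<le> 1" "\<And>k. 4 ^ k < \<bar>dual_apply (f (r k)) (y k)\<bar>"
    by metis
  obtain w where w: "\<And>k. (1/2) ^ k *\<^sub>R y k \<le> w" using ex_geometric_majorant[of y, OF y(1,2)] by blast
  have "Bseq (\<lambda>n. dual_apply \<bar>f n\<bar> w)"
    using null unfolding weak_star_null_def by (intro convergent_imp_Bseq convergentI) blast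
  then obtain K where K: "\<And>n. \<bar>dual_apply \<bar>f n\<bar> w\<bar> \<le> K" unfolding Bseq_def by auto
  have le_K: "2 ^ k \<le> K" for k :: nat
  proof -
    have "(2::real) ^ k = (1/2) ^ k * 4 ^ k" by (simp flip: power_mult_distrib)
    also have "\<dots> \<le> (1/2) ^ k * dual_apply \<bar>f (r k)\<bar> (y k)"
      using y(3)[of k] abs_dual_apply_le[of "f (r k)" "y k"] y(1)[of k] by (intro mult_left_mono) auto
    also have "\<dots> = dual_apply \<bar>f (r k)\<bar> ((1/2) ^ k *\<^sub>R y k)" by (simp add: dual_apply_linear)
    also have "\<dots> \<le> dual_apply \<bar>f (r k)\<bar> w" by (intro dual_apply_mono w) simp
    also have "\<dots> \<le> K" using K[of "r k"] by linarith
    finally show ?thesis .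
  qed
  obtain k where "K < 2 ^ k" using real_arch_pow[of 2 K] by auto
  then show False using le_K[of k] by simp
qed

text \<open>For positive \<open>x\<close>, \<open>T x\<close> dominates each single term of its
  series, so \<open>g N (T x)\<close> is at least \<open>g N (y N) * \<psi> N x\<close>, which stays
  large for suitable \<open>x\<close> in the unit ball.\<close>

lemma ex_positive_weak_almost_limited_not_almost_limited:
  assumes d: "property_d TYPE('b::banach_lattice)" and "\<not> positive_dual_schur TYPE('b)"
    and "\<not> order_continuous_norm TYPE('a::banach_lattice dual)"
  shows "\<exists>T :: 'a \<Rightarrow>\<^sub>L 'b. positive_operator T \<and> weak_almost_limited T \<and> \<not> almost_limited T"
proof -
  obtain g :: "nat \<Rightarrow> 'b dual" and y p where g: "disjoint_seq g" "weak_star_null g" "\<And>n. 0 \<le> g n"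
    and y: "0 < p" "\<And>n. 0 \<le> y n" "\<And>n. norm (y n) \<le> 1" "\<And>n. p \<le> dual_apply (g n) (y n)"
    using not_positive_dual_schur_witness[OF assms(2)] by metis
  obtain \<psi> :: "nat \<Rightarrow> 'a dual" and \<phi> q where psi: "\<And>n. 0 \<le> \<psi> n" "\<And>N. (\<Sum>n<N. \<psi> n) \<le> \<phi>"
    and q: "0 < q" "\<And>n. q \<le> norm (\<psi> n)"
    using not_order_continuous_dual_witness[OF assms(3)] by metis
  obtain T :: "'a \<Rightarrow>\<^sub>L 'b" where T: "\<And>x. (\<lambda>n. dual_apply (\<psi> n) x *\<^sub>R y n) sums blinfun_apply T x"
    "\<And>N x. norm (blinfun_apply T x - (\<Sum>n<N. dual_apply (\<psi> n) x *\<^sub>R y n)) \<le> tail \<psi> N x"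
    using ex_series_operator[of \<psi> \<phi> y, OF psi y(3)] by metis
  have T_ge: "dual_apply (\<psi> n) x *\<^sub>R y n \<le> blinfun_apply T x" if "0 \<le> x" for n x
  proof -
    have nn: "0 \<le> dual_apply (\<psi> k) x *\<^sub>R y k" for k
      using psi y that by (intro scaleR_nonneg_nonneg dual_apply_nonneg)
    have "(\<lambda>m. (\<Sum>k<m + Suc n. dual_apply (\<psi> k) x *\<^sub>R y k) - dual_apply (\<psi> n) x *\<^sub>R y n)
        \<longlonglongrightarrow> blinfun_apply T x - dual_apply (\<psi> n) x *\<^sub>R y n"
      using T(1)[of x] unfolding sums_def by (intro tendsto_intros LIMSEQ_ignore_initial_segment)
    moreover have "dual_apply (\<psi> n) x *\<^sub>R y n \<le> (\<Sum>k<m + Suc n. dual_apply (\<psi> k) x *\<^sub>R y k)" for m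
      by (rule member_le_sum_nonneg[where u = "\<lambda>k. dual_apply (\<psi> k) x *\<^sub>R y k"]) (use nn in auto)
    ultimately show ?thesis using nonneg_limit by fastforce
  qed
  have pos: "positive_operator T"
    unfolding positive_operator_def
    using order_trans[OF scaleR_nonneg_nonneg[OF dual_apply_nonneg[OF psi(1)] y(2)] T_ge] by blast
  \<comment> \<open>Uniformly small tails over \<open>A\<close> reduce \<open>T\<close> to a finite
    sum, on which the weak* null \<open>f k\<close> act through finitely many
    \<open>y n\<close>.\<close>
  have "weak_almost_limited T"
    unfolding weak_almost_limited_def
  proof (intro allI impI almost_limited_setI)
    fix A :: "'a set" assume A: "relatively_weakly_compact A"
    obtain C where C: "\<And>n. 0 \<le> C n" "\<And>n x. x \<in> A \<Longrightarrow> \<bar>dual_apply (\<psi> n) x\<bar> \<le> C n"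
      using relatively_weakly_compact_bounded[OF A, of "\<psi> _"] by metis
    have tails: "\<exists>N. \<forall>x\<in>A. tail \<psi> N x \<le> e" if "0 < e" for e
      using relatively_weakly_compact_tail[of \<psi> \<phi>, OF psi A that] .
    show "bounded (blinfun_apply T ` A)"
    proof -
      obtain N where N: "\<And>x. x \<in> A \<Longrightarrow> tail \<psi> N x \<le> 1" using tails[of 1] by auto
      have "norm (blinfun_apply T x) \<le> 1 + (\<Sum>n<N. C n)" if x: "x \<in> A" for x
      proof -
        have "norm (\<Sum>n<N. dual_apply (\<psi> n) x *\<^sub>R y n) \<le> (\<Sum>n<N. C n)"
          using C x y(3) by (intro sum_norm_le) (auto intro: mult_mono[of _ "C _" _ 1, simplified])
        then show ?thesis
          using norm_triangle_sub[of "blinfun_apply T x" "\<Sum>n<N. dual_apply (\<psi> n) x *\<^sub>R y n"]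
            T(2)[of x N] N[OF x] by linarith
      qed
      then show ?thesis by (auto simp: bounded_iff)
    qed
    fix f :: "nat \<Rightarrow> 'b dual" and e :: real
    assume f: "disjoint_seq f" "weak_star_null f" and e: "0 < e"
    have "weak_star_null (\<lambda>n. \<bar>f n\<bar>)" using d f by (simp add: property_d_def)
    then obtain M where M: "0 < M" "\<And>n. norm (f n) \<le> M" using weak_star_null_abs_bounded by blast
    \<comment> \<open>The bound \<open>M\<close> on the norms turns this tail into an error of at
      most \<open>e / 2\<close>.\<close>
    obtain N where N: "\<And>x. x \<in> A \<Longrightarrow> tail \<psi> N x \<le> e / (2 * M)" using tails[of "e / (2 * M)"] e M by auto
    have "(\<lambda>k. \<Sum>n<N. C n * \<bar>dual_apply (f k) (y n)\<bar>) \<longlonglongrightarrow> (\<Sum>n<N. C n * \<bar>0\<bar>)"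
      using f(2) unfolding weak_star_null_def by (intro tendsto_intros) auto
    then have "\<forall>\<^sub>F k in sequentially. (\<Sum>n<N. C n * \<bar>dual_apply (f k) (y n)\<bar>) < e / 2"
      using e by (intro order_tendstoD) auto
    then obtain K where K: "\<And>k. K \<le> k \<Longrightarrow> (\<Sum>n<N. C n * \<bar>dual_apply (f k) (y n)\<bar>) < e / 2"
      by (auto simp: eventually_sequentially)
    have "\<bar>dual_apply (f k) (blinfun_apply T x)\<bar> \<le> e" if k: "K \<le> k" and x: "x \<in> A" for k x
    proof -
      let ?s = "\<Sum>n<N. dual_apply (\<psi> n) x *\<^sub>R y n"
      have "\<bar>dual_apply (f k) (blinfun_apply T x - ?s)\<bar> \<le> norm (f k) * norm (blinfun_apply T x - ?s)"
        by (rule dual_norm_le)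
      also have "\<dots> \<le> M * (e / (2 * M))"
        using M T(2)[of x N] N[OF x] by (intro mult_mono) auto
      also have "\<dots> = e / 2" using M by simp
      finally have 1: "\<bar>dual_apply (f k) (blinfun_apply T x - ?s)\<bar> \<le> e / 2" .
      have "\<bar>dual_apply (f k) ?s\<bar> \<le> (\<Sum>n<N. C n * \<bar>dual_apply (f k) (y n)\<bar>)"
        unfolding dual_apply_sum using C x
        by (intro order_trans[OF sum_abs] sum_mono) (auto simp: dual_apply_linear abs_mult intro!: mult_right_mono)
      then show ?thesis using 1 K[OF k] unfolding dual_apply_linear(2) by linarith
    qed
    then show "\<exists>K. \<forall>k\<ge>K. \<forall>z\<in>blinfun_apply T ` A. \<bar>dual_apply (f k) z\<bar> \<le> e" by blast
  qed
  moreover have "\<not> almost_limited T"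
  proof
    assume "almost_limited T"
    then have "almost_limited_set (blinfun_apply T ` cball 0 1)" by (simp add: almost_limited_def)
    moreover have pq: "0 < p * (q / 4)" using y(1) q(1) by simp
    ultimately obtain N where N: "\<And>x. norm x \<le> 1 \<Longrightarrow> \<bar>dual_apply (g N) (blinfun_apply T x)\<bar> < p * (q / 4)"
      using almost_limited_setD[OF _ g(1,2) pq] by fastforce
    \<comment> \<open>The witness lemma loses a factor 2; a quarter of \<open>q\<close> keeps its
      inequality strict.\<close>
    have "2 * (q / 4) < norm (\<psi> N)" using q(1) q(2)[of N] by simp
    moreover have "0 \<le> q / 4" using q(1) by simp
    ultimately obtain x where x: "0 \<le> x" "norm x \<le> 1" "q / 4 < \<bar>dual_apply (\<psi> N) x\<bar>"
      by (rule norm_dual_witness)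
    have "p * (q / 4) \<le> dual_apply (g N) (y N) * dual_apply (\<psi> N) x"
      using x dual_apply_nonneg[OF psi(1) x(1), of N] y(1) y(4)[of N] q(1) by (intro mult_mono) auto
    also have "\<dots> = dual_apply (g N) (dual_apply (\<psi> N) x *\<^sub>R y N)" by (simp add: dual_apply_linear)
    also have "\<dots> \<le> dual_apply (g N) (blinfun_apply T x)" by (intro dual_apply_mono g T_ge x)
    finally show False using N[OF x(2)] by simp
  qed
  ultimately show ?thesis using pos by blast
qed

lemma positive_operator_imp_order_bounded:
  assumes "positive_operator T"
  shows "order_bounded_operator T"
proof -
  have "blinfun_apply T x \<le> blinfun_apply T y" if "x \<le> y" for x y
    using assms that unfolding positive_operator_def
    by (metis blinfun.diff_right diff_ge_0_iff_ge)
  then have "blinfun_apply T ` {a..b} \<subseteq> {blinfun_apply T a..blinfun_apply T b}" for a b by auto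
  then show ?thesis unfolding order_bounded_operator_def by blast
qed

theorem theorem2p7:
  assumes "property_d TYPE('f::banach_lattice)"
  shows
    "((\<forall>T :: 'e::banach_lattice \<Rightarrow>\<^sub>L 'f.
          order_bounded_operator T \<and> weak_almost_limited T \<longrightarrow> almost_limited T) \<longleftrightarrow>
      (\<forall>T :: 'e \<Rightarrow>\<^sub>L 'f.
          positive_operator T \<and> weak_almost_limited T \<longrightarrow> almost_limited T)) \<and>
     ((\<forall>T :: 'e \<Rightarrow>\<^sub>L 'f.
          positive_operator T \<and> weak_almost_limited T \<longrightarrow> almost_limited T) \<longleftrightarrow>
      (positive_dual_schur TYPE('f) \<or> order_continuous_norm TYPE('e dual)))"
  \<comment> \<open>Positive operators are order bounded, which links the first two statements; the
    counterexample gives the dichotomy by contraposition; the two sufficient conditions close the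
    circle.\<close>
  using positive_operator_imp_order_bounded[where 'a = 'e and 'b = 'f]
    positive_dual_schur_imp_almost_limited[OF assms, where 'a = 'e]
    order_continuous_dual_imp_almost_limited[OF assms, where 'a = 'e]
    ex_positive_weak_almost_limited_not_almost_limited[OF assms, where 'a = 'e]
  by blast

end
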